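(* Let $p\in(d,\infty)$. There exists a constant $S_\infty(\Omega,\eta)>0$, depending only on $\Omega$ and $\eta$, such that the following holds. Assume: (i) for some $K\le S_\infty(\Omega,\eta)$ (with $K>0$) there is a sequence of Borel maps $T_n:\Omega\to V_n$ with $T_n\#\mu=\mu_n$ and $\sup_{x\in\Omega}|T_n(x)-x|\le K\varepsilon_n$ for every $n\in\mathbb N$; (ii) $\eta$ is continuous at $0$, non-increasing, and $\eta(0)>0$; (iii) there is $D>0$ with $\frac1D\le\rho(x)\le D$ for all $x\in\Omega$; and there exists $t>p$ such that $\aleph_\eta^t<+\infty$. Consider the uniform graph Sobolev inequality: there exists a constant $C>0$ such that for every $n\in\mathbb N$ and every $u:V_n\to\mathbb R$, $$\sup_{x\in V_n}|u(x)|\le C\left(\|u\|_{L^p(V_n;\mu_n)}+(\mathcal{GE}_n^p(u))^{1/p}\right).\qquad(\ast)$$ Then $(\ast)$ holds if the sequence $\left(\frac{\varepsilon_n^p\Lambda_n^+}{(\Lambda_n^-)^2}\right)_{n\in\mathbb N}$ is bounded. Moreover, if in addition (iv) there is $\mathfrak D>0$ such that $\frac{1}{\mathfrak D|V_n|}\le\mu_n(x)\le\frac{\mathfrak D}{|V_n|}$ for all $n\in\mathbb N$ and $x\in V_n$, then $(\ast)$ holds if and only if the sequence $\left(\varepsilon_n|V_n|^{1/p}\right)_{n\in\mathbb N}$ is bounded.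
   Context: $\mathbb N=\{1,2,\dots\}$; $d\in\mathbb N$; $\Omega\subset\mathbb R^d$ is open and bounded with Lipschitz boundary (near each boundary point, in suitable orthonormal coordinates, $\Omega$ is the region on one side of the graph of a Lipschitz function). $\mu$ is a probability measure on $\Omega$ with continuous density $\rho:\Omega\to\mathbb R$ with respect to Lebesgue measure. For $n\in\mathbb N$, $V_n\subset\Omega$ is a finite set, $\mu_n$ is a probability measure on $V_n$ (also regarded as a measure on $\Omega$), $\mu_n(x):=\mu_n(\{x\})$, $\Lambda_n^-:=\min_{x\in V_n}\mu_n(x)$, $\Lambda_n^+:=\max_{x\in V_n}\mu_n(x)$. $(\varepsilon_n)_{n\in\mathbb N}$ is a sequence of positive reals with $\varepsilon_n\to0$. The kernel is a function $\eta:[0,\infty)\to[0,\infty)$, and $\eta_\varepsilon(r):=\varepsilon^{-d}\eta(r/\varepsilon)$ for $\varepsilon>0$. For $t\ge0$, $\aleph_\eta^t:=\int_0^\infty\eta(r)r^{d+t-1}\,dr$. The push-forward is $T\#\mu(A):=\mu(T^{-1}(A))$. For $u:V_n\to\mathbb R$ and $p\ge1$, $$\|u\|_{L^p(V_n;\mu_n)}:=\Big(\sum_{x\in V_n}|u(x)|^p\mu_n(x)\Big)^{1/p},\qquad \mathcal{GE}_n^p(u):=\frac1{\varepsilon_n^p}\sum_{x\in V_n}\sum_{y\in V_n}\eta_{\varepsilon_n}(|x-y|)|u(x)-u(y)|^p\mu_n(x)\mu_n(y).$$ *)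

theory Defs
  imports "HOL-Probability.Probability"
begin

text \<open>
  The unit vector \<open>e\<close> is the vertical axis of the local orthonormal coordinates: \<open>y\<close> has height
  \<open>e \<bullet> y\<close> and horizontal part \<open>y - (e \<bullet> y) *\<^sub>R e\<close>, which lies in the hyperplane orthogonal
  to \<open>e\<close>. Replacing \<open>e\<close> by \<open>- e\<close> and \<open>g\<close> by \<open>- g\<close> exchanges the two sides of the graph.
\<close>
definition lipschitz_boundary :: "(real^'d) set \<Rightarrow> bool" where
  "lipschitz_boundary \<Omega> \<longleftrightarrow>
     (\<forall>x\<in>frontier \<Omega>. \<exists>e r g L. norm e = 1 \<and> r > 0 \<and> L-lipschitz_on {z. e \<bullet> z = 0} g \<and>
        \<Omega> \<inter> ball x r = {y \<in> ball x r. e \<bullet> y > (g (y - (e \<bullet> y) *\<^sub>R e) :: real)})"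

text \<open>
  Kernels are functions on \<open>[0,\<infinity>)\<close>; they are rendered by total functions \<open>\<eta> :: real \<Rightarrow> real\<close>, whose
  values at negative arguments are never used.
\<close>
definition scaled_kernel :: "nat \<Rightarrow> (real \<Rightarrow> real) \<Rightarrow> real \<Rightarrow> real \<Rightarrow> real" where
  "scaled_kernel d \<eta> \<epsilon> r = \<eta> (r / \<epsilon>) / \<epsilon> ^ d"

definition kernel_moment :: "nat \<Rightarrow> (real \<Rightarrow> real) \<Rightarrow> real \<Rightarrow> ennreal" where
  "kernel_moment d \<eta> t = (\<integral>\<^sup>+ r \<in> {0..}. ennreal (\<eta> r * r powr (real d + t - 1)) \<partial>lborel)"

definition min_mass :: "'a set \<Rightarrow> 'a measure \<Rightarrow> real" where
  "min_mass V M = Min ((\<lambda>x. measure M {x}) ` V)"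

definition max_mass :: "'a set \<Rightarrow> 'a measure \<Rightarrow> real" where
  "max_mass V M = Max ((\<lambda>x. measure M {x}) ` V)"

definition graph_Lp_norm :: "real \<Rightarrow> 'a set \<Rightarrow> 'a measure \<Rightarrow> ('a \<Rightarrow> real) \<Rightarrow> real" where
  "graph_Lp_norm p V M u = (\<Sum>x\<in>V. \<bar>u x\<bar> powr p * measure M {x}) powr (1 / p)"

definition graph_energy ::
  "(real \<Rightarrow> real) \<Rightarrow> real \<Rightarrow> real \<Rightarrow> (real^'d) set \<Rightarrow> (real^'d) measure \<Rightarrow> (real^'d \<Rightarrow> real) \<Rightarrow> real" where
  "graph_energy \<eta> p \<epsilon> V M u =
     1 / \<epsilon> powr p * (\<Sum>x\<in>V. \<Sum>y\<in>V. scaled_kernel CARD('d) \<eta> \<epsilon> (norm (x - y)) *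
                         \<bar>u x - u y\<bar> powr p * measure M {x} * measure M {y})"

text \<open>
  Sequences are indexed by the positive integers. A function on \<open>V n\<close> is rendered by a total
  function, only its values on \<open>V n\<close> being used.
\<close>
definition uniform_graph_sobolev ::
  "(real \<Rightarrow> real) \<Rightarrow> real \<Rightarrow> (nat \<Rightarrow> real) \<Rightarrow> (nat \<Rightarrow> (real^'d) set) \<Rightarrow> (nat \<Rightarrow> (real^'d) measure) \<Rightarrow> bool"
where
  "uniform_graph_sobolev \<eta> p \<epsilon> V \<mu>V \<longleftrightarrow>
     (\<exists>C>0. \<forall>n\<ge>1. \<forall>u :: real^'d \<Rightarrow> real.
        (SUP x\<in>V n. \<bar>u x\<bar>) \<le>
          C * (graph_Lp_norm p (V n) (\<mu>V n) u + graph_energy \<eta> p (\<epsilon> n) (V n) (\<mu>V n) u powr (1 / p)))"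

text \<open>
  The condition that \<open>\<epsilon>\<^sub>n\<^sup>p \<Lambda>\<^sub>n\<^sup>+ / (\<Lambda>\<^sub>n\<^sup>-)\<^sup>2\<close> is bounded. It presupposes that the quotients are finite;
  because \<open>x / 0 = 0\<close> in HOL, this has to be said explicitly.
\<close>
definition mass_ratio_bounded ::
  "real \<Rightarrow> (nat \<Rightarrow> real) \<Rightarrow> (nat \<Rightarrow> 'a set) \<Rightarrow> (nat \<Rightarrow> 'a measure) \<Rightarrow> bool" where
  "mass_ratio_bounded p \<epsilon> V \<mu>V \<longleftrightarrow>
     (\<forall>n\<ge>1. min_mass (V n) (\<mu>V n) > 0) \<and>
     bounded ((\<lambda>n. \<epsilon> n powr p * max_mass (V n) (\<mu>V n) / (min_mass (V n) (\<mu>V n))\<^sup>2) ` {1..})"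

end

theory Submission
  imports Defs
begin

text \<open>
  Fix one graph of the sequence, write \<open>\<epsilon>\<close>, \<open>V\<close>, \<open>M\<close>, \<open>T\<close> for its data and \<open>d\<close> for the dimension,
  and transport a function \<open>u\<close> on \<open>V\<close> to the function \<open>v = u \<circ> T\<close> on \<open>\<Omega>\<close>. The kernel is bounded
  below by a positive constant on some interval \<open>[0, r]\<close>, and \<open>T\<close> moves points by at most
  \<open>r \<epsilon> / 4\<close>; so points of \<open>\<Omega>\<close> at distance at most \<open>r \<epsilon> / 2\<close> are mapped to vertices at distance at
  most \<open>r \<epsilon>\<close>, and the graph energy of \<open>u\<close> controls the nonlocal energy of \<open>v\<close>, the double integral
  of \<open>\<bar>v x - v y\<bar> powr p\<close> over the pairs with \<open>norm (x - y) \<le> r \<epsilon> / 2\<close>. This is why \<open>S = r / 4\<close>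
  is an admissible choice.

  The supremum bound is a Morrey estimate at scales above \<open>\<epsilon>\<close>. On a convex set of diameter \<open>R\<close>, a
  segment between two points is cut into about \<open>R / \<epsilon>\<close> short steps; translation invariance then
  gives a Poincare inequality with the short-range energy on the right
  (\<open>nonlocal_poincare_convex\<close>). Hence the averages of \<open>v\<close> over a convex set of size \<open>s\<close> and over a
  similar subset of size \<open>s / 2\<close> differ by at most a constant times \<open>s powr (1 - d / p)\<close> times the
  \<open>p\<close>-th root of the energy. As \<open>p > d\<close>, these differences sum to a bounded quantity along
  \<open>s, s / 2, s / 4, \<dots>\<close> (\<open>cone_average_chain\<close>). Every vertex is the tip of such a family of convex
  sets in \<open>\<Omega>\<close>, namely of truncated cones of uniform size: this is the interior cone property of
  bounded Lipschitz domains (\<open>uniform_interior_cone\<close>). The average over the largest cone is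
  controlled by the \<open>L\<^sup>p\<close> norm. At the scale \<open>\<epsilon>\<close>, the \<open>p\<close>-th power of
  the distance between \<open>u x\<close> and the average over the cone is controlled by the contribution of the
  single vertex \<open>x\<close> to the energy, divided by the mass of \<open>x\<close>; this costs a factor
  \<open>\<epsilon> powr p / M {x}\<close>, and it is the only place where the masses of single vertices matter
  (\<open>vertex_sobolev_bound\<close>). Each of the boundedness conditions of the theorem makes this factor
  bounded.

  Conversely, the inequality is tested with the indicator function of a vertex
  (\<open>bounded_if_uniform_graph_sobolev\<close>). Its norm and its energy are explicit, once the weighted
  degree of a vertex is known to be bounded uniformly. For the latter, a monotone kernel with a finite
  moment of order \<open>t\<close> decays like \<open>s powr - (d + t)\<close>, while the mass of the shell of the points at
  distance between \<open>k \<epsilon>\<close> and \<open>(k + 1) \<epsilon>\<close> from the vertex is at most of order \<open>((k + 1) \<epsilon>) ^ d\<close>.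
\<close>

section \<open>Jensen's inequality for averages\<close>

text \<open>
  Summed over a finite set, or integrated over a set, with the mean in the role of \<open>c\<close>, the linear
  term cancels. The two forms of Jensen's inequality below arise in this way.
\<close>
lemma powr_above_tangent:
  fixes p c z :: real
  assumes "p \<ge> 1" "c \<ge> 0" "z \<ge> 0"
  shows "c powr p + p * c powr (p - 1) * (z - c) \<le> z powr p"
proof (cases "c = 0 \<or> z = 0")
  case True
  have "c powr (p - 1) * c = c powr p" if "c > 0"
    using that by (simp add: powr_diff)
  then show ?thesis
    using True assms by (cases "c = 0") (auto simp: algebra_simps)
next
  case False
  then have pos: "c > 0" "z > 0" using assms by auto
  have "z powr p - c powr p \<ge> (p * c powr (p - 1)) * (z - c)"
  proof (rule convex_on_imp_above_tangent[OF powr_convex[OF \<open>p \<ge> 1\<close>]])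
    show "((\<lambda>x. x powr p) has_real_derivative p * c powr (p - 1)) (at c within {0<..})"
      using has_real_derivative_powr[OF pos(1)] DERIV_subset by blast
  qed (use pos in \<open>auto simp: interior_open\<close>)
  then show ?thesis by simp
qed

lemma powr_sum_le:
  fixes a :: "'i \<Rightarrow> real" and p :: real
  assumes "p \<ge> 1" "finite I" "I \<noteq> {}" and a: "\<And>i. i \<in> I \<Longrightarrow> a i \<ge> 0"
  shows "(\<Sum>i\<in>I. a i) powr p \<le> real (card I) powr (p - 1) * (\<Sum>i\<in>I. a i powr p)"
proof -
  define N where "N = real (card I)"
  define c where "c = (\<Sum>i\<in>I. a i) / N"
  have N: "N > 0" using assms by (simp add: N_def card_gt_0_iff)
  have c: "c \<ge> 0" unfolding c_def using N a by (simp add: sum_nonneg)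
  have "N * c powr p = (\<Sum>i\<in>I. c powr p + p * c powr (p - 1) * (a i - c))"
    using N by (simp add: sum.distrib sum_distrib_left[symmetric] sum_subtractf N_def[symmetric] c_def)
  also have "\<dots> \<le> (\<Sum>i\<in>I. a i powr p)"
    by (intro sum_mono powr_above_tangent assms c)
  finally have *: "N * c powr p \<le> (\<Sum>i\<in>I. a i powr p)" .
  have "(\<Sum>i\<in>I. a i) powr p = N powr (p - 1) * (N * c powr p)"
    using N a by (simp add: c_def powr_divide sum_nonneg powr_diff)
  also have "\<dots> \<le> N powr (p - 1) * (\<Sum>i\<in>I. a i powr p)"
    by (intro mult_left_mono *) auto
  finally show ?thesis unfolding N_def .
qed

definition set_average :: "'a::euclidean_space set \<Rightarrow> ('a \<Rightarrow> real) \<Rightarrow> real" where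
  "set_average A v = (LINT x:A|lborel. v x) / measure lborel A"

text \<open>
  Jensen's inequality for \<open>\<bar>c - v x\<bar> powr p\<close> on \<open>A\<close>. The measure of \<open>A\<close> is kept as a factor on the
  left, and the right-hand side is a nonnegative integral, so that the estimate can be iterated
  and enlarged to bigger domains of integration without integrability conditions.
\<close>
lemma powr_dist_set_average_le:
  fixes v :: "'a::euclidean_space \<Rightarrow> real"
  assumes p: "p \<ge> 1" and [measurable]: "A \<in> sets borel" "v \<in> borel_measurable borel"
    and A: "emeasure lborel A > 0" "emeasure lborel A < \<infinity>" and bnd: "\<And>x. \<bar>v x\<bar> \<le> B"
  shows "ennreal (\<bar>c - set_average A v\<bar> powr p) * emeasure lborel A
    \<le> (\<integral>\<^sup>+x\<in>A. ennreal (\<bar>c - v x\<bar> powr p) \<partial>lborel)"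
proof -
  define m where "m = measure lborel A"
  have m: "m > 0" "emeasure lborel A = ennreal m"
    using A unfolding m_def by (auto simp: measure_def enn2real_positive_iff)
  define f where "f x = \<bar>c - v x\<bar>" for x
  have [measurable]: "f \<in> borel_measurable borel" unfolding f_def by measurable
  have fb: "f x \<ge> 0" "f x \<le> \<bar>c\<bar> + B" for x unfolding f_def using bnd[of x] by auto
  have int: "set_integrable lborel A g"
    if [measurable]: "g \<in> borel_measurable borel" and g: "\<And>x. \<bar>g x\<bar> \<le> b" for g :: "'a \<Rightarrow> real" and b
    unfolding set_integrable_def
  proof (rule Bochner_Integration.integrable_bound[of _ "\<lambda>x. indicator A x *\<^sub>R b"])
    show "integrable lborel (\<lambda>x. indicator A x *\<^sub>R b)"
      using A by (intro integrable_scaleR_left) auto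
    show "AE x in lborel. norm (indicator A x *\<^sub>R g x) \<le> norm (indicator A x *\<^sub>R b)"
      using g by (intro AE_I2) (auto simp: indicator_def intro: order_trans[OF g])
  qed auto
  have iv: "set_integrable lborel A v" by (rule int[OF _ bnd]) auto
  have ic: "set_integrable lborel A (\<lambda>_. k)" for k :: real by (rule int[of _ "\<bar>k\<bar>"]) auto
  have iF: "set_integrable lborel A f" by (rule int[of _ "\<bar>c\<bar> + B"]) (use fb in auto)
  have iP: "set_integrable lborel A (\<lambda>x. f x powr p)"
    by (rule int[of _ "(\<bar>c\<bar> + B) powr p"]) (use fb p in \<open>auto intro!: powr_mono2\<close>)
  define b where "b = (LINT x:A|lborel. f x) / m"
  have LC: "(LINT x:A|lborel. k) = k * m" for k :: real
    unfolding m_def using A by (simp add: set_lebesgue_integral_def measure_def)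
  have b0: "b \<ge> 0" unfolding b_def set_lebesgue_integral_def
    using fb m by (intro divide_nonneg_pos integral_nonneg_AE) auto
  have "c - set_average A v = (LINT x:A|lborel. c - v x) / m"
    using m by (simp add: set_integral_diff[OF ic iv] LC set_average_def m_def[symmetric] field_simps)
  then have "\<bar>c - set_average A v\<bar> = \<bar>LINT x:A|lborel. c - v x\<bar> / m" using m by simp
  also have "\<bar>LINT x:A|lborel. c - v x\<bar> \<le> (LINT x:A|lborel. f x)"
    using set_integral_norm_bound[OF set_integral_diff(1)[OF ic iv], of c] by (simp add: f_def)
  finally have "\<bar>c - set_average A v\<bar> \<le> b" unfolding b_def using m by (simp add: divide_right_mono)
  then have "\<bar>c - set_average A v\<bar> powr p * m \<le> b powr p * m"
    using p m by (intro mult_right_mono powr_mono2) auto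
  also have "\<dots> = (LINT x:A|lborel. b powr p + p * b powr (p - 1) * (f x - b))"
    using m by (simp add: set_integral_add ic iF LC set_integral_diff b_def)
  also have "\<dots> \<le> (LINT x:A|lborel. f x powr p)"
    by (intro set_integral_mono iP set_integral_add ic set_integral_diff set_integrable_mult_right iF
        powr_above_tangent p b0 fb)
  finally have *: "\<bar>c - set_average A v\<bar> powr p * m \<le> (LINT x:A|lborel. f x powr p)" .
  have "ennreal (\<bar>c - set_average A v\<bar> powr p) * emeasure lborel A
      = ennreal (\<bar>c - set_average A v\<bar> powr p * m)"
    using m by (simp add: ennreal_mult'[symmetric])
  also have "\<dots> \<le> ennreal (LINT x:A|lborel. f x powr p)" by (rule ennreal_leI[OF *])
  also have "\<dots> = (\<integral>\<^sup>+x\<in>A. ennreal (f x powr p) \<partial>lborel)"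
    unfolding set_lebesgue_integral_def using iP[unfolded set_integrable_def]
    by (subst nn_integral_eq_integral[symmetric])
      (auto simp: indicator_mult_ennreal[symmetric] mult.commute intro!: nn_integral_cong split: split_indicator)
  finally show ?thesis unfolding f_def .
qed

lemma powr_dist_set_averages_le:
  fixes v :: "'a::euclidean_space \<Rightarrow> real"
  assumes p: "p \<ge> 1" and [measurable]: "A \<in> sets borel" "A' \<in> sets borel" "v \<in> borel_measurable borel"
    and A: "emeasure lborel A > 0" "emeasure lborel A < \<infinity>"
      "emeasure lborel A' > 0" "emeasure lborel A' < \<infinity>" and bnd: "\<And>x. \<bar>v x\<bar> \<le> B"
  shows "ennreal (\<bar>set_average A v - set_average A' v\<bar> powr p) * emeasure lborel A * emeasure lborel A'
    \<le> (\<integral>\<^sup>+x\<in>A. (\<integral>\<^sup>+y\<in>A'. ennreal (\<bar>v x - v y\<bar> powr p) \<partial>lborel) \<partial>lborel)"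
proof -
  have "ennreal (\<bar>set_average A v - set_average A' v\<bar> powr p) * emeasure lborel A * emeasure lborel A'
    \<le> (\<integral>\<^sup>+x\<in>A. ennreal (\<bar>set_average A' v - v x\<bar> powr p) \<partial>lborel) * emeasure lborel A'"
    using powr_dist_set_average_le[OF p _ _ A(1,2), of v B "set_average A' v"] bnd
    by (intro mult_right_mono) (auto simp: abs_minus_commute)
  also have "\<dots> = (\<integral>\<^sup>+x\<in>A. ennreal (\<bar>set_average A' v - v x\<bar> powr p) * emeasure lborel A' \<partial>lborel)"
    by (subst nn_integral_multc[symmetric]) (auto simp: mult_ac)
  also have "\<dots> \<le> (\<integral>\<^sup>+x\<in>A. (\<integral>\<^sup>+y\<in>A'. ennreal (\<bar>v x - v y\<bar> powr p) \<partial>lborel) \<partial>lborel)"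
    using powr_dist_set_average_le[OF p _ _ A(3,4), of v B] bnd
    by (intro nn_integral_mono mult_right_mono) (auto simp: abs_minus_commute)
  finally show ?thesis .
qed

section \<open>A nonlocal Poincare inequality\<close>

lemma nn_integral_lborel_shift:
  fixes f :: "'a::euclidean_space \<Rightarrow> ennreal"
  assumes [measurable]: "f \<in> borel_measurable borel"
  shows "(\<integral>\<^sup>+x. f (a + x) \<partial>lborel) = (\<integral>\<^sup>+x. f x \<partial>lborel)"
  by (subst (2) lborel_distr_plus[of a, symmetric], subst nn_integral_distr) auto

lemma nn_integral_lborel_affine:
  fixes f :: "'a::euclidean_space \<Rightarrow> ennreal"
  assumes [measurable]: "f \<in> borel_measurable borel" and "c \<noteq> 0"
  shows "(\<integral>\<^sup>+x. f x \<partial>lborel) = ennreal (\<bar>c\<bar> ^ DIM('a)) * (\<integral>\<^sup>+x. f (a + c *\<^sub>R x) \<partial>lborel)"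
  by (subst lborel_affine[OF \<open>c \<noteq> 0\<close>, of a], subst nn_integral_density)
    (auto simp: nn_integral_distr nn_integral_cmult ennreal_power)

text \<open>
  Replacing \<open>y\<close> by \<open>h = (y - x) / N\<close> turns the \<open>i\<close>-th step of the segment from \<open>x\<close> to \<open>y\<close> into the
  pair \<open>(x + i h, x + i h + h)\<close>. For fixed \<open>h\<close>, the shift by \<open>i h\<close> does not change the integral over
  \<open>x\<close>. Only the Jacobian \<open>N ^ d\<close> of the substitution remains.
\<close>
lemma nn_integral_segment_step:
  fixes W :: "'a::euclidean_space \<Rightarrow> 'a \<Rightarrow> ennreal"
  assumes [measurable]: "case_prod W \<in> borel_measurable (borel \<Otimes>\<^sub>M borel)" and N: "N \<ge> (1::nat)"
  shows "(\<integral>\<^sup>+x. (\<integral>\<^sup>+y. W (x + (real i / N) *\<^sub>R (y - x)) (x + (real (Suc i) / N) *\<^sub>R (y - x)) \<partial>lborel) \<partial>lborel)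
    = ennreal (real N ^ DIM('a)) * (\<integral>\<^sup>+x. (\<integral>\<^sup>+y. W x y \<partial>lborel) \<partial>lborel)"
proof -
  have frac: "(real N + real N * real i) / real N = 1 + real i" using N by (simp add: field_simps)
  have "(\<integral>\<^sup>+y. W (x + (real i / N) *\<^sub>R (y - x)) (x + (real (Suc i) / N) *\<^sub>R (y - x)) \<partial>lborel)
    = ennreal (real N ^ DIM('a)) * (\<integral>\<^sup>+h. W (real i *\<^sub>R h + x) (real i *\<^sub>R h + x + h) \<partial>lborel)" for x
    using N by (subst nn_integral_lborel_affine[of _ "real N" x])
      (auto simp: algebra_simps frac intro!: arg_cong2[where f="(*)"] nn_integral_cong)
  then have "(\<integral>\<^sup>+x. (\<integral>\<^sup>+y. W (x + (real i / N) *\<^sub>R (y - x)) (x + (real (Suc i) / N) *\<^sub>R (y - x)) \<partial>lborel) \<partial>lborel)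
    = ennreal (real N ^ DIM('a)) * (\<integral>\<^sup>+x. (\<integral>\<^sup>+h. W (real i *\<^sub>R h + x) (real i *\<^sub>R h + x + h) \<partial>lborel) \<partial>lborel)"
    by (simp add: nn_integral_cmult)
  also have "(\<integral>\<^sup>+x. (\<integral>\<^sup>+h. W (real i *\<^sub>R h + x) (real i *\<^sub>R h + x + h) \<partial>lborel) \<partial>lborel)
    = (\<integral>\<^sup>+h. (\<integral>\<^sup>+x. W (real i *\<^sub>R h + x) (real i *\<^sub>R h + x + h) \<partial>lborel) \<partial>lborel)"
    by (rule lborel_pair.Fubini') simp
  also have "\<dots> = (\<integral>\<^sup>+h. (\<integral>\<^sup>+x. W x (x + h) \<partial>lborel) \<partial>lborel)"
    by (subst nn_integral_lborel_shift[of "\<lambda>x. W x (x + h)" for h]) auto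
  also have "\<dots> = (\<integral>\<^sup>+x. (\<integral>\<^sup>+h. W x (x + h) \<partial>lborel) \<partial>lborel)"
    by (rule lborel_pair.Fubini') simp
  also have "\<dots> = (\<integral>\<^sup>+x. (\<integral>\<^sup>+y. W x y \<partial>lborel) \<partial>lborel)"
    by (subst nn_integral_lborel_shift[of "\<lambda>y. W x y" for x]) auto
  finally show ?thesis .
qed

text \<open>
  A Poincare inequality whose right-hand side sees only pairs at distance at most \<open>l\<close>. The increment
  of \<open>v\<close> from \<open>x\<close> to \<open>y\<close> is the sum of its increments over the \<open>N\<close> equal pieces of the segment, which
  stays in \<open>A\<close> by convexity and whose pieces have length at most \<open>l\<close>. The power mean inequality
  contributes \<open>N powr (p - 1)\<close>, and each of the \<open>N\<close> pieces contributes \<open>N ^ d\<close> by the preceding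
  lemma.
\<close>
lemma nonlocal_poincare_convex:
  fixes v :: "'a::euclidean_space \<Rightarrow> real"
  assumes p: "p \<ge> 1" and A: "convex A" and [measurable]: "A \<in> sets borel" "v \<in> borel_measurable borel"
    and diam: "\<And>x y. x \<in> A \<Longrightarrow> y \<in> A \<Longrightarrow> norm (x - y) \<le> real N * l" and N: "N \<ge> 1"
  shows "(\<integral>\<^sup>+x\<in>A. (\<integral>\<^sup>+y\<in>A. ennreal (\<bar>v x - v y\<bar> powr p) \<partial>lborel) \<partial>lborel)
    \<le> ennreal (real N powr (p + DIM('a))) *
       (\<integral>\<^sup>+x\<in>A. (\<integral>\<^sup>+y\<in>A. ennreal (\<bar>v x - v y\<bar> powr p) * indicator {..l} (norm (x - y)) \<partial>lborel) \<partial>lborel)"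
    (is "?L \<le> _ * ?R")
proof -
  define W where "W x y = ennreal (\<bar>v x - v y\<bar> powr p) * indicator {..l} (norm (x - y)) *
    indicator A y * indicator A x" for x y
  have [measurable]: "case_prod W \<in> borel_measurable (borel \<Otimes>\<^sub>M borel)"
    unfolding W_def by measurable
  define z where "z x y i = x + (real i / N) *\<^sub>R (y - x)" for x y :: 'a and i :: nat
  \<comment> \<open>The indicators inside \<open>W\<close> vanish at no point of the chain, because the chain stays in \<open>A\<close>.\<close>
  have step: "ennreal (\<bar>v x - v y\<bar> powr p) * indicator A y * indicator A x
      \<le> ennreal (real N powr (p - 1)) * (\<Sum>i<N. W (z x y i) (z x y (Suc i)))" for x y
  proof (cases "x \<in> A \<and> y \<in> A")
    case True
    have zA: "z x y i \<in> A" if "i \<le> N" for i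
    proof -
      have "(1 - real i / N) *\<^sub>R x + (real i / N) *\<^sub>R y \<in> A"
        using True that N by (intro convexD[OF A]) (auto simp: field_simps)
      then show ?thesis by (simp add: z_def algebra_simps)
    qed
    have zd: "norm (z x y i - z x y (Suc i)) \<le> l" for i
    proof -
      have "z x y i - z x y (Suc i) = (1 / N) *\<^sub>R (x - y)"
        using N by (simp add: z_def algebra_simps add_divide_distrib)
      then have "norm (z x y i - z x y (Suc i)) = norm (x - y) / N" by simp
      also have "\<dots> \<le> l" using diam[of x y] True N by (simp add: field_simps)
      finally show ?thesis .
    qed
    have Wz: "W (z x y i) (z x y (Suc i)) = ennreal (\<bar>v (z x y i) - v (z x y (Suc i))\<bar> powr p)"
      if "i < N" for i
      using that zA[of i] zA[of "Suc i"] zd[of i] by (simp add: W_def)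
    have "v y - v x = (\<Sum>i<N. v (z x y (Suc i)) - v (z x y i))"
      using N by (subst sum_lessThan_telescope) (simp add: z_def)
    then have "\<bar>v x - v y\<bar> \<le> (\<Sum>i<N. \<bar>v (z x y i) - v (z x y (Suc i))\<bar>)"
      using sum_abs[of "\<lambda>i. v (z x y (Suc i)) - v (z x y i)" "{..<N}"] by (simp add: abs_minus_commute)
    then have "\<bar>v x - v y\<bar> powr p \<le> (\<Sum>i<N. \<bar>v (z x y i) - v (z x y (Suc i))\<bar>) powr p"
      using p by (intro powr_mono2) auto
    also have "\<dots> \<le> real N powr (p - 1) * (\<Sum>i<N. \<bar>v (z x y i) - v (z x y (Suc i))\<bar> powr p)"
      using powr_sum_le[OF p, of "{..<N}" "\<lambda>i. \<bar>v (z x y i) - v (z x y (Suc i))\<bar>"] N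
      by (auto simp: lessThan_empty_iff)
    finally have "ennreal (\<bar>v x - v y\<bar> powr p)
      \<le> ennreal (real N powr (p - 1) * (\<Sum>i<N. \<bar>v (z x y i) - v (z x y (Suc i))\<bar> powr p))"
      by (rule ennreal_leI)
    also have "\<dots> = ennreal (real N powr (p - 1)) * (\<Sum>i<N. W (z x y i) (z x y (Suc i)))"
      by (subst ennreal_mult) (auto simp: Wz sum_nonneg)
    finally show ?thesis using True by simp
  qed auto
  have [measurable]: "(\<lambda>x. \<integral>\<^sup>+y. W (z x y i) (z x y (Suc i)) \<partial>lborel) \<in> borel_measurable borel" for i
    unfolding z_def by measurable
  have [measurable]: "(\<lambda>y. W (z x y i) (z x y (Suc i))) \<in> borel_measurable borel" for x i
    unfolding z_def by measurable
  have "?L = (\<integral>\<^sup>+x. (\<integral>\<^sup>+y. ennreal (\<bar>v x - v y\<bar> powr p) * indicator A y * indicator A x \<partial>lborel) \<partial>lborel)"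
    by (simp add: nn_integral_multc)
  also have "\<dots> \<le> (\<integral>\<^sup>+x. (\<integral>\<^sup>+y. ennreal (real N powr (p - 1)) * (\<Sum>i<N. W (z x y i) (z x y (Suc i))) \<partial>lborel) \<partial>lborel)"
    by (intro nn_integral_mono step)
  also have "\<dots> = ennreal (real N powr (p - 1)) *
      (\<Sum>i<N. (\<integral>\<^sup>+x. (\<integral>\<^sup>+y. W (z x y i) (z x y (Suc i)) \<partial>lborel) \<partial>lborel))"
    by (simp add: nn_integral_cmult nn_integral_sum)
  also have "\<dots> = ennreal (real N powr (p - 1)) *
      (\<Sum>i<N. ennreal (real N ^ DIM('a)) * (\<integral>\<^sup>+x. (\<integral>\<^sup>+y. W x y \<partial>lborel) \<partial>lborel))"
    unfolding z_def using N by (subst nn_integral_segment_step) auto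
  also have "(\<integral>\<^sup>+x. (\<integral>\<^sup>+y. W x y \<partial>lborel) \<partial>lborel) = ?R"
    unfolding W_def by (simp add: nn_integral_multc)
  also have "ennreal (real N powr (p - 1)) * (\<Sum>i<N. ennreal (real N ^ DIM('a)) * ?R)
    = ennreal (real N powr (p - 1) * (real N * real N ^ DIM('a))) * ?R"
    by (simp add: ennreal_mult mult.assoc ennreal_of_nat_eq_real_of_nat)
  also have "real N powr (p - 1) * (real N * real N ^ DIM('a)) = real N powr (p + DIM('a))"
    using N by (simp add: powr_add powr_diff powr_realpow)
  finally show ?thesis .
qed

section \<open>The interior cone property\<close>

text \<open>
  The solid cone with tip \<open>x\<close>, axis \<open>e\<close>, slope \<open>q\<close> and height \<open>s\<close>, with a rounded base and without its
  tip. Described as a union of open balls it is open, contains a ball of radius comparable to \<open>s\<close>,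
  and grows with \<open>s\<close>; the cones of heights \<open>s\<close> and \<open>s / 2\<close> are similar.
\<close>
definition truncated_cone :: "'a::real_normed_vector \<Rightarrow> 'a \<Rightarrow> real \<Rightarrow> real \<Rightarrow> 'a set" where
  "truncated_cone x e q s = (\<Union>t\<in>{0<..s}. ball (x + t *\<^sub>R e) (t * q))"

lemma open_truncated_cone: "open (truncated_cone x e q s)"
  unfolding truncated_cone_def by auto

lemma truncated_cone_mono:
  "q \<le> q' \<Longrightarrow> s \<le> s' \<Longrightarrow> truncated_cone x e q s \<subseteq> truncated_cone x e q' s'"
  unfolding truncated_cone_def by (intro UN_mono subset_ball mult_left_mono) auto

lemma ball_subset_truncated_cone:
  "0 < s \<Longrightarrow> ball (x + s *\<^sub>R e) (s * q) \<subseteq> truncated_cone x e q s"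
  unfolding truncated_cone_def by auto

lemma norm_diff_truncated_cone_le:
  assumes "norm e = 1" "q \<le> 1" "y \<in> truncated_cone x e q s"
  shows "norm (y - x) \<le> 2 * s"
proof -
  obtain t where t: "0 < t" "t \<le> s" "dist (x + t *\<^sub>R e) y < t * q"
    using assms(3) unfolding truncated_cone_def by auto
  have "norm (y - x) \<le> norm (y - (x + t *\<^sub>R e)) + norm (t *\<^sub>R e)"
    using norm_triangle_ineq[of "y - (x + t *\<^sub>R e)" "t *\<^sub>R e"] by simp
  also have "\<dots> \<le> t * q + t" using t assms(1) by (simp add: dist_norm norm_minus_commute)
  also have "t * q \<le> t * 1" using t assms(2) by (intro mult_left_mono) auto
  finally show ?thesis using t by simp
qed

lemma convex_truncated_cone: "convex (truncated_cone x e q s)"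
proof (rule convexI)
  fix y z :: 'a and a b :: real
  assume y: "y \<in> truncated_cone x e q s" and z: "z \<in> truncated_cone x e q s"
    and ab: "0 \<le> a" "0 \<le> b" "a + b = 1"
  obtain t where t: "0 < t" "t \<le> s" "norm (y - (x + t *\<^sub>R e)) < t * q"
    using y unfolding truncated_cone_def by (auto simp: dist_norm norm_minus_commute)
  obtain r where r: "0 < r" "r \<le> s" "norm (z - (x + r *\<^sub>R e)) < r * q"
    using z unfolding truncated_cone_def by (auto simp: dist_norm norm_minus_commute)
  define w where "w = a * t + b * r"
  have comb: "a * c + b * d < a * c' + b * d'" if "c < c'" "d < d'" for c c' d d' :: real
  proof (cases "a = 0")
    case False
    then have "a * c < a * c'" using ab that by simp
    moreover have "b * d \<le> b * d'" using ab that by (simp add: mult_left_mono)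
    ultimately show ?thesis by simp
  qed (use ab that in auto)
  have "0 < w" using comb[of 0 t 0 r] t r by (simp add: w_def)
  moreover have "w \<le> s"
    using mult_left_mono[OF t(2) ab(1)] mult_left_mono[OF r(2) ab(2)] ab(3)
    by (simp add: w_def) (metis distrib_right mult_1 add_mono)
  moreover have "norm ((a *\<^sub>R y + b *\<^sub>R z) - (x + w *\<^sub>R e)) < w * q"
  proof -
    have "x = a *\<^sub>R x + b *\<^sub>R x" using ab by (simp add: scaleR_left_distrib[symmetric])
    then have "(a *\<^sub>R y + b *\<^sub>R z) - (x + w *\<^sub>R e)
        = (a *\<^sub>R y + b *\<^sub>R z) - ((a *\<^sub>R x + b *\<^sub>R x) + w *\<^sub>R e)" by simp
    also have "\<dots> = a *\<^sub>R (y - (x + t *\<^sub>R e)) + b *\<^sub>R (z - (x + r *\<^sub>R e))"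
      by (simp add: w_def algebra_simps)
    also have "norm \<dots> \<le> a * norm (y - (x + t *\<^sub>R e)) + b * norm (z - (x + r *\<^sub>R e))"
      using norm_triangle_ineq[of "a *\<^sub>R (y - (x + t *\<^sub>R e))" "b *\<^sub>R (z - (x + r *\<^sub>R e))"] ab by simp
    also have "\<dots> < a * (t * q) + b * (r * q)" by (rule comb[OF t(3) r(3)])
    finally show ?thesis by (simp add: w_def algebra_simps)
  qed
  ultimately show "a *\<^sub>R y + b *\<^sub>R z \<in> truncated_cone x e q s"
    unfolding truncated_cone_def by (intro UN_I[of w]) (auto simp: dist_norm norm_minus_commute)
qed

lemma emeasure_truncated_cone:
  fixes x e :: "'a::euclidean_space"
  assumes "norm e = 1" "0 < q" "q \<le> 1" "0 < s"
  shows "emeasure lborel (truncated_cone x e q s) \<ge> ennreal (unit_ball_vol DIM('a) * (s * q) ^ DIM('a))"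
    and "emeasure lborel (truncated_cone x e q s) < \<infinity>"
    and "emeasure lborel (truncated_cone x e q s) > 0"
proof -
  have "emeasure lborel (ball (x + s *\<^sub>R e) (s * q)) \<le> emeasure lborel (truncated_cone x e q s)"
    using open_truncated_cone[of x e q s] \<open>0 < s\<close> by (intro emeasure_mono ball_subset_truncated_cone) auto
  then show *: "emeasure lborel (truncated_cone x e q s) \<ge> ennreal (unit_ball_vol DIM('a) * (s * q) ^ DIM('a))"
    using assms by (simp add: emeasure_ball)
  show "emeasure lborel (truncated_cone x e q s) > 0"
    using assms by (intro less_le_trans[OF _ *]) (auto simp: ennreal_zero_less_mult_iff zero_less_mult_iff)
  have "truncated_cone x e q s \<subseteq> cball x (2 * s)"
    using norm_diff_truncated_cone_le[OF assms(1,3)] by (auto simp: dist_norm norm_minus_commute)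
  then show "emeasure lborel (truncated_cone x e q s) < \<infinity>"
    using bounded_subset[OF bounded_cball] emeasure_bounded_finite by blast
qed

text \<open>
  Walking up by \<open>t\<close> along the axis while deviating by less than \<open>t q\<close> raises the height by more than
  \<open>t - t q\<close>, whereas the graph below rises by at most \<open>L t q\<close>. The condition on \<open>q\<close> makes the first
  quantity the larger one.
\<close>
lemma lipschitz_graph_truncated_cone:
  fixes e :: "real^'d"
  assumes e: "norm e = 1" and g: "L-lipschitz_on {z. e \<bullet> z = 0} g"
    and q: "q * (1 + L) \<le> 1" and x: "e \<bullet> x > (g (x - (e \<bullet> x) *\<^sub>R e) :: real)"
    and y: "y \<in> truncated_cone x e q s"
  shows "e \<bullet> y > g (y - (e \<bullet> y) *\<^sub>R e)"
proof -
  \<comment> \<open>\<open>P\<close> is the orthogonal projection to the hyperplane on which \<open>g\<close> is defined; it does not increase norms.\<close>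
  define P where "P z = z - (e \<bullet> z) *\<^sub>R e" for z
  have ee: "e \<bullet> e = 1" using e by (simp add: dot_square_norm)
  have L: "L \<ge> 0" using g lipschitz_on_nonneg by blast
  obtain t where t: "0 < t" "dist (x + t *\<^sub>R e) y < t * q"
    using y unfolding truncated_cone_def by auto
  define w where "w = y - (x + t *\<^sub>R e)"
  have w: "norm w < t * q" using t by (simp add: w_def dist_norm norm_minus_commute)
  have yw: "y = x + t *\<^sub>R e + w" by (simp add: w_def)
  have "\<bar>e \<bullet> w\<bar> \<le> norm w" using Cauchy_Schwarz_ineq2[of e w] e by simp
  then have ey: "e \<bullet> y > e \<bullet> x + t - t * q" using w by (simp add: yw inner_add_right ee)
  have P: "e \<bullet> P z = 0" for z by (simp add: P_def inner_diff_right ee)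
  have "P y - P x = P w" by (simp add: P_def yw inner_add_right ee algebra_simps)
  moreover have "norm (P w) \<le> norm w"
  proof (rule power2_le_imp_le)
    have "(norm (P w))\<^sup>2 = (norm w)\<^sup>2 - (e \<bullet> w)\<^sup>2"
      unfolding P_def power2_norm_eq_inner
      by (simp add: inner_diff_left inner_diff_right ee inner_commute[of w e] power2_eq_square)
    then show "(norm (P w))\<^sup>2 \<le> (norm w)\<^sup>2" by simp
  qed simp
  ultimately have "dist (P y) (P x) \<le> t * q" using w by (simp add: dist_norm)
  then have "\<bar>g (P y) - g (P x)\<bar> \<le> L * (t * q)"
    using lipschitz_onD[OF g, of "P y" "P x"] P L
    by (auto simp: dist_real_def intro: order_trans mult_left_mono)
  then have "g (P y) \<le> g (P x) + L * (t * q)" by simp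
  also have "\<dots> < e \<bullet> x + L * (t * q)" using x by (simp add: P_def)
  also have "\<dots> = e \<bullet> x + t * (q * (1 + L)) - t * q" by (simp add: algebra_simps)
  also have "\<dots> \<le> e \<bullet> x + t - t * q" using mult_left_mono[OF q, of t] t by simp
  also have "\<dots> < e \<bullet> y" by (rule ey)
  finally show ?thesis by (simp add: P_def)
qed

text \<open>
  The interior cone property. Near a boundary point the cone points in the vertical direction of the
  local graph coordinates, with a slope determined by the Lipschitz constant; near an interior point
  any direction will do. Compactness of the closure makes the size uniform. One number \<open>q\<close> serves
  as slope, height and radius of the neighbourhood, which is possible because a cone
  shrinks when its slope and its height decrease.
\<close>
lemma uniform_interior_cone:
  fixes \<Omega> :: "(real^'d) set"
  assumes "open \<Omega>" "bounded \<Omega>" "lipschitz_boundary \<Omega>"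
  obtains q where "0 < q" "q \<le> 1"
    "\<And>x. x \<in> \<Omega> \<Longrightarrow> \<exists>e. norm e = 1 \<and> truncated_cone x e q q \<subseteq> \<Omega>"
proof -
  \<comment> \<open>A cone of height \<open>q\<close> has its points within \<open>2 * q\<close> of the tip, hence the bound on \<open>3 * q\<close> in both cases.\<close>
  have loc: "\<exists>q. 0 < q \<and> q \<le> 1 \<and>
      (\<forall>x\<in>\<Omega> \<inter> ball z q. \<exists>e. norm e = 1 \<and> truncated_cone x e q q \<subseteq> \<Omega>)" if z: "z \<in> closure \<Omega>" for z
  proof (cases "z \<in> \<Omega>")
    case True
    then obtain R where R: "R > 0" "ball z R \<subseteq> \<Omega>" using \<open>open \<Omega>\<close> openE by blast
    define q where "q = min 1 (R / 4)"
    have q: "0 < q" "q \<le> 1" "3 * q < R" using R by (auto simp: q_def min_def)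
    obtain e :: "real^'d" where e: "norm e = 1" using vector_choose_size[of 1] by auto
    have "truncated_cone x e q q \<subseteq> \<Omega>" if "x \<in> ball z q" for x
    proof
      fix y assume "y \<in> truncated_cone x e q q"
      then have "dist x y \<le> 2 * q"
        using norm_diff_truncated_cone_le[OF e q(2), of y x q] by (simp add: dist_norm norm_minus_commute)
      then have "y \<in> ball z R" using that q(3) dist_triangle[of z y x] by simp
      then show "y \<in> \<Omega>" using R by auto
    qed
    then show ?thesis using q(1,2) e by (intro exI[of _ q] conjI ballI exI[of _ e]) auto
  next
    case False
    then have "z \<in> frontier \<Omega>" using z interior_open[OF \<open>open \<Omega>\<close>] by (simp add: frontier_def)
    then obtain e r g L where e: "norm e = 1" and r: "r > 0" and g: "L-lipschitz_on {z. e \<bullet> z = 0} g"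
      and eq: "\<Omega> \<inter> ball z r = {y \<in> ball z r. e \<bullet> y > (g (y - (e \<bullet> y) *\<^sub>R e) :: real)}"
      using assms(3) unfolding lipschitz_boundary_def by meson
    have L: "L \<ge> 0" using g lipschitz_on_nonneg by blast
    define q where "q = min (1 / (1 + L)) (r / 4)"
    have le: "q \<le> 1 / (1 + L)" "1 / (1 + L) \<le> 1" "q \<le> r / 4" "0 < q"
      using L r by (auto simp: q_def)
    have q: "0 < q" "q \<le> 1" "3 * q < r" using order_trans[OF le(1,2)] le(3,4) by linarith+
    have qL: "q * (1 + L) \<le> 1" using mult_right_mono[OF le(1), of "1 + L"] L by simp
    have "truncated_cone x e q q \<subseteq> \<Omega>" if x: "x \<in> \<Omega> \<inter> ball z q" for x
    proof
      fix y assume y: "y \<in> truncated_cone x e q q"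
      then have "dist x y \<le> 2 * q"
        using norm_diff_truncated_cone_le[OF e q(2), of y x q] by (simp add: dist_norm norm_minus_commute)
      then have yr: "y \<in> ball z r" using x q(3) dist_triangle[of z y x] by simp
      have "x \<in> \<Omega> \<inter> ball z r" using x q by auto
      then have "e \<bullet> x > g (x - (e \<bullet> x) *\<^sub>R e)" using eq by blast
      from lipschitz_graph_truncated_cone[OF e g qL this y] show "y \<in> \<Omega>" using yr eq by blast
    qed
    then show ?thesis using q(1,2) e by (intro exI[of _ q] conjI ballI exI[of _ e]) auto
  qed
  define cone_nhd where "cone_nhd z q \<longleftrightarrow> 0 < q \<and> q \<le> 1 \<and>
      (\<forall>x\<in>\<Omega> \<inter> ball z q. \<exists>e. norm e = 1 \<and> truncated_cone x e q q \<subseteq> \<Omega>)" for z q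
  have "\<forall>z\<in>closure \<Omega>. \<exists>q. cone_nhd z q" using loc by (simp add: cone_nhd_def)
  from bchoice[OF this] obtain Q where Q: "\<And>z. z \<in> closure \<Omega> \<Longrightarrow> cone_nhd z (Q z)" by blast
  have cpt: "compact (closure \<Omega>)" using \<open>bounded \<Omega>\<close> by (simp add: compact_closure)
  have Qpos: "0 < Q z" if "z \<in> closure \<Omega>" for z
    using Q[OF that] by (simp add: cone_nhd_def)
  have cover: "closure \<Omega> \<subseteq> (\<Union>z\<in>closure \<Omega>. ball z (Q z))"
  proof
    fix z assume z: "z \<in> closure \<Omega>"
    then have "z \<in> ball z (Q z)" using Qpos by simp
    then show "z \<in> (\<Union>z\<in>closure \<Omega>. ball z (Q z))" using z by blast
  qed
  obtain F where F: "F \<subseteq> closure \<Omega>" "finite F" "closure \<Omega> \<subseteq> (\<Union>z\<in>F. ball z (Q z))"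
    by (rule compactE_image[OF cpt open_ball cover], rule that)
  define q where "q = Min (insert 1 (Q ` F))"
  have "q \<in> insert 1 (Q ` F)" unfolding q_def using F by (intro Min_in) auto
  then have "0 < q" using Qpos F(1) by auto
  moreover have "q \<le> 1" unfolding q_def using F by auto
  moreover have "\<exists>e. norm e = 1 \<and> truncated_cone x e q q \<subseteq> \<Omega>" if "x \<in> \<Omega>" for x
  proof -
    have "x \<in> closure \<Omega>" using that closure_subset by auto
    then obtain z where z: "z \<in> F" "x \<in> ball z (Q z)" using F by auto
    then have "z \<in> closure \<Omega>" using F(1) by blast
    from Q[OF this] have "\<forall>x\<in>\<Omega> \<inter> ball z (Q z). \<exists>e. norm e = 1 \<and> truncated_cone x e (Q z) (Q z) \<subseteq> \<Omega>"
      unfolding cone_nhd_def by (elim conjE)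
    from bspec[OF this IntI[OF that z(2)]] obtain e
      where e: "norm e = 1" "truncated_cone x e (Q z) (Q z) \<subseteq> \<Omega>" by (elim exE conjE)
    have "q \<le> Q z" unfolding q_def using F z by auto
    then have "truncated_cone x e q q \<subseteq> truncated_cone x e (Q z) (Q z)" by (intro truncated_cone_mono)
    with e have "norm e = 1 \<and> truncated_cone x e q q \<subseteq> \<Omega>" by simp
    then show ?thesis by (rule exI)
  qed
  ultimately show ?thesis using that by blast
qed

section \<open>A Morrey estimate along shrinking cones\<close>

text \<open>
  The Poincare inequality on the larger cone, with \<open>N \<le> 8 s / l\<close> pieces per segment, bounds the
  double integral of \<open>\<bar>v x - v y\<bar> powr p\<close> by \<open>E (8 s) powr (p + d)\<close>: the energy scales in such a way
  that \<open>l\<close> disappears. Division by the volumes of the two cones, both at least of order \<open>s ^ d\<close>,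
  leaves \<open>s powr (p - d)\<close>.
\<close>
lemma cone_average_dyadic_step:
  fixes v :: "'a::euclidean_space \<Rightarrow> real" and p :: real
  assumes p: "p \<ge> 1" and q: "0 < q" "q \<le> 1" and e: "norm e = 1"
    and cone: "truncated_cone x e q q \<subseteq> \<Omega>" and [measurable]: "\<Omega> \<in> sets borel" "v \<in> borel_measurable borel"
    and bnd: "\<And>x. \<bar>v x\<bar> \<le> B" and E: "E \<ge> 0" and l: "l > 0"
    and energy: "(\<integral>\<^sup>+x\<in>\<Omega>. (\<integral>\<^sup>+y\<in>\<Omega>. ennreal (\<bar>v x - v y\<bar> powr p) * indicator {..l} (norm (x - y)) \<partial>lborel) \<partial>lborel)
      \<le> ennreal (E * l powr (p + DIM('a)))"
    and s: "0 < s" "s \<le> q" "l \<le> 4 * s"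
  defines "Q \<equiv> 8 powr (p + DIM('a)) * 2 ^ DIM('a) / (unit_ball_vol DIM('a) * q ^ DIM('a))\<^sup>2"
  shows "\<bar>set_average (truncated_cone x e q s) v - set_average (truncated_cone x e q (s / 2)) v\<bar>
    \<le> (Q * E) powr (1 / p) * s powr ((p - DIM('a)) / p)"
proof -
  define A where "A = truncated_cone x e q s"
  define A' where "A' = truncated_cone x e q (s / 2)"
  define X where "X = \<bar>set_average A v - set_average A' v\<bar>"
  define d where "d = DIM('a)"
  define \<omega> where "\<omega> = unit_ball_vol d"
  have \<omega>: "\<omega> > 0" by (simp add: \<omega>_def)
  have [measurable]: "A \<in> sets borel" "A' \<in> sets borel"
    by (simp_all add: A_def A'_def open_truncated_cone)
  have sub: "A' \<subseteq> A" "A \<subseteq> \<Omega>"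
    using truncated_cone_mono[of q q "s / 2" s x e] truncated_cone_mono[of q q s q x e] s cone
    by (auto simp: A_def A'_def)
  have mA: "emeasure lborel A \<ge> ennreal (\<omega> * (s * q) ^ d)" "emeasure lborel A < \<infinity>" "emeasure lborel A > 0"
    using emeasure_truncated_cone[OF e q s(1)] by (simp_all add: A_def \<omega>_def d_def)
  have mA': "emeasure lborel A' \<ge> ennreal (\<omega> * (s / 2 * q) ^ d)" "emeasure lborel A' < \<infinity>" "emeasure lborel A' > 0"
    using emeasure_truncated_cone[OF e q, of "s / 2"] s by (simp_all add: A'_def \<omega>_def d_def)
  \<comment> \<open>The cone has diameter at most \<open>4 * s\<close>, so \<open>N\<close> pieces per segment suffice for steps of length at most \<open>l\<close>.\<close>
  define N where "N = nat \<lceil>4 * s / l\<rceil>"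
  have "1 \<le> 4 * s / l" using s l by (simp add: field_simps)
  then have N: "N \<ge> 1" "4 * s / l \<le> real N" "real N \<le> 8 * s / l"
    unfolding N_def by linarith+
  have diam: "norm (y - z) \<le> real N * l" if "y \<in> A" "z \<in> A" for y z
  proof -
    have "norm (y - z) \<le> norm (y - x) + norm (z - x)" using norm_triangle_ineq4[of "y - x" "z - x"] by simp
    also have "\<dots> \<le> 4 * s"
      using norm_diff_truncated_cone_le[OF e q(2), of y x s] norm_diff_truncated_cone_le[OF e q(2), of z x s] that
      unfolding A_def by simp
    also have "\<dots> \<le> real N * l" using N l by (simp add: field_simps)
    finally show ?thesis .
  qed
  have "ennreal (X powr p * (\<omega> * (s * q) ^ d) * (\<omega> * (s / 2 * q) ^ d))
      = ennreal (X powr p) * ennreal (\<omega> * (s * q) ^ d) * ennreal (\<omega> * (s / 2 * q) ^ d)"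
    using \<omega> s q by (simp add: ennreal_mult)
  also have "\<dots> \<le> ennreal (X powr p) * emeasure lborel A * emeasure lborel A'"
    by (intro mult_mono mA mA') auto
  also have "\<dots> \<le> (\<integral>\<^sup>+x\<in>A. (\<integral>\<^sup>+y\<in>A'. ennreal (\<bar>v x - v y\<bar> powr p) \<partial>lborel) \<partial>lborel)"
    unfolding X_def by (rule powr_dist_set_averages_le[OF p _ _ _ mA(3,2) mA'(3,2) bnd]) auto
  also have "\<dots> \<le> (\<integral>\<^sup>+x\<in>A. (\<integral>\<^sup>+y\<in>A. ennreal (\<bar>v x - v y\<bar> powr p) \<partial>lborel) \<partial>lborel)"
    using sub by (intro nn_integral_mono mult_right_mono mult_left_mono) (auto simp: indicator_def)
  also have "\<dots> \<le> ennreal (real N powr (p + d)) *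
       (\<integral>\<^sup>+x\<in>A. (\<integral>\<^sup>+y\<in>A. ennreal (\<bar>v x - v y\<bar> powr p) * indicator {..l} (norm (x - y)) \<partial>lborel) \<partial>lborel)"
    unfolding d_def by (rule nonlocal_poincare_convex[OF p _ _ _ diam N(1)])
      (auto simp: A_def convex_truncated_cone open_truncated_cone)
  also have "\<dots> \<le> ennreal (real N powr (p + d)) *
       (\<integral>\<^sup>+x\<in>\<Omega>. (\<integral>\<^sup>+y\<in>\<Omega>. ennreal (\<bar>v x - v y\<bar> powr p) * indicator {..l} (norm (x - y)) \<partial>lborel) \<partial>lborel)"
    using sub by (intro nn_integral_mono mult_mono mult_left_mono) (auto simp: indicator_def)
  also have "\<dots> \<le> ennreal (real N powr (p + d)) * ennreal (E * l powr (p + d))"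
    unfolding d_def by (intro mult_left_mono energy) auto
  also have "\<dots> = ennreal (E * (real N * l) powr (p + d))"
    using E l by (simp add: ennreal_mult'[symmetric] powr_mult mult_ac)
  also have "\<dots> \<le> ennreal (E * (8 * s) powr (p + d))"
    using N l E p by (intro ennreal_leI mult_left_mono powr_mono2) (auto simp: field_simps)
  finally have "X powr p * (\<omega> * (s * q) ^ d) * (\<omega> * (s / 2 * q) ^ d) \<le> E * (8 * s) powr (p + d)"
    using E by (subst (asm) ennreal_le_iff) auto
  then have "X powr p \<le> E * (8 * s) powr (p + d) / ((\<omega> * (s * q) ^ d) * (\<omega> * (s / 2 * q) ^ d))"
    using \<omega> s q by (simp add: field_simps)
  also have "\<dots> = (Q * E) * s powr (p - d)"
    using s q \<omega> unfolding Q_def d_def[symmetric] \<omega>_def[symmetric]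
    by (simp add: powr_mult powr_add powr_diff powr_realpow power_mult_distrib power_divide field_simps power2_eq_square)
  finally have "(X powr p) powr (1 / p) \<le> ((Q * E) * s powr (p - d)) powr (1 / p)"
    using p by (intro powr_mono2) auto
  also have "\<dots> = (Q * E) powr (1 / p) * s powr ((p - d) / p)"
    using E p s by (subst powr_mult) (auto simp: powr_powr Q_def)
  also have "(X powr p) powr (1 / p) = X" using p by (simp add: powr_powr X_def)
  finally show ?thesis unfolding X_def A_def A'_def d_def .
qed

text \<open>
  With exponent \<open>\<alpha> = 1 - d / p > 0\<close>, the bound \<open>s powr \<alpha>\<close> for one halving is a constant multiple of
  the difference \<open>s powr \<alpha> - (s / 2) powr \<alpha>\<close>. Therefore the bounds telescope, and the result does
  not depend on the number \<open>k\<close> of halvings. The last halving starts at height \<open>2 * (q / 2 ^ k)\<close>,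
  which has to be at least \<open>l / 4\<close>.
\<close>
lemma cone_average_chain:
  fixes v :: "'a::euclidean_space \<Rightarrow> real" and p :: real
  assumes p: "p > DIM('a)" and q: "0 < q" "q \<le> 1" and e: "norm e = 1"
    and cone: "truncated_cone x e q q \<subseteq> \<Omega>" and meas: "\<Omega> \<in> sets borel" "v \<in> borel_measurable borel"
    and bnd: "\<And>x. \<bar>v x\<bar> \<le> B" and E: "E \<ge> 0" and l: "l > 0"
    and energy: "(\<integral>\<^sup>+x\<in>\<Omega>. (\<integral>\<^sup>+y\<in>\<Omega>. ennreal (\<bar>v x - v y\<bar> powr p) * indicator {..l} (norm (x - y)) \<partial>lborel) \<partial>lborel)
      \<le> ennreal (E * l powr (p + DIM('a)))"
    and k: "k = 0 \<or> l \<le> 8 * (q / 2 ^ k)"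
  defines "Q \<equiv> 8 powr (p + DIM('a)) * 2 ^ DIM('a) / (unit_ball_vol DIM('a) * q ^ DIM('a))\<^sup>2"
    and "\<alpha> \<equiv> (p - DIM('a)) / p"
  shows "\<bar>set_average (truncated_cone x e q q) v - set_average (truncated_cone x e q (q / 2 ^ k)) v\<bar>
    \<le> Q powr (1 / p) / (1 - (1 / 2) powr \<alpha>) * E powr (1 / p)"
proof -
  have p1: "p \<ge> 1" "p > 0" using p DIM_positive[where 'a='a] by linarith+
  define a where "a j = set_average (truncated_cone x e q (q / 2 ^ j)) v" for j
  define c where "c = 1 - (1 / 2::real) powr \<alpha>"
  have \<alpha>: "\<alpha> > 0" unfolding \<alpha>_def using p p1 by simp
  have "(1 / 2::real) powr \<alpha> < 1" using \<alpha> powr_less_mono2[of \<alpha> "1 / 2" 1] by simp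
  then have c: "c > 0" by (simp add: c_def)
  define M where "M = (Q * E) powr (1 / p) / c"
  have M: "M \<ge> 0" unfolding M_def using c by simp
  have "\<bar>a 0 - a j\<bar> \<le> M * (q powr \<alpha> - (q / 2 ^ j) powr \<alpha>)" if "j \<le> k" for j
    using that
  proof (induction j)
    case (Suc j)
    define s where "s = q / 2 ^ j"
    have s: "0 < s" "s \<le> q" "q / 2 ^ Suc j = s / 2"
      using q by (auto simp: s_def field_simps)
    have "(2::real) ^ Suc j \<le> 2 ^ k" using Suc.prems by (intro power_increasing) auto
    then have "q / 2 ^ k \<le> q / 2 ^ Suc j" using q by (intro divide_left_mono) auto
    then have "l \<le> 4 * s" using k Suc.prems s(3) by auto
    from cone_average_dyadic_step[OF p1(1) q e cone meas bnd E l energy s(1,2) this]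
    have "\<bar>a j - a (Suc j)\<bar> \<le> (Q * E) powr (1 / p) * s powr \<alpha>"
      unfolding a_def s(3) s_def[symmetric] Q_def \<alpha>_def .
    also have "\<dots> = M * (s powr \<alpha> - (s / 2) powr \<alpha>)"
    proof -
      have half: "(s / 2) powr \<alpha> = (1 - c) * s powr \<alpha>"
        using s powr_mult[of s "1/2" \<alpha>] by (simp add: c_def)
      have "(Q * E) powr (1 / p) = M * c" using c by (simp add: M_def)
      then show ?thesis unfolding half by (simp add: algebra_simps)
    qed
    finally have "\<bar>a j - a (Suc j)\<bar> \<le> M * (s powr \<alpha> - (s / 2) powr \<alpha>)" .
    moreover have "\<bar>a 0 - a j\<bar> \<le> M * (q powr \<alpha> - s powr \<alpha>)"
      using Suc by (simp add: s_def)
    ultimately show ?case unfolding s(3) by (simp add: algebra_simps)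
  qed simp
  from this[of k] have "\<bar>a 0 - a k\<bar> \<le> M * (q powr \<alpha> - (q / 2 ^ k) powr \<alpha>)" by simp
  also have "\<dots> \<le> M * 1"
    using M q \<alpha> powr_mono2[of \<alpha> q 1] by (intro mult_left_mono) (auto intro: order_trans[of _ "q powr \<alpha>"])
  also have "\<dots> = Q powr (1 / p) / c * E powr (1 / p)"
    unfolding M_def by (subst powr_mult) (use E in \<open>simp_all add: Q_def\<close>)
  finally show ?thesis by (simp add: a_def c_def)
qed

section \<open>Graphs transported from a domain\<close>

text \<open>
  One graph of the sequence with its transport map. The estimates are proved for a single graph, so
  that uniformity along the sequence reduces to inspecting which parameters occur in the constants.
\<close>
locale transported_graph =
  fixes \<Omega> :: "(real^'d) set" and \<rho> :: "real^'d \<Rightarrow> real" and \<mu> :: "(real^'d) measure"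
    and V :: "(real^'d) set" and M :: "(real^'d) measure" and T :: "real^'d \<Rightarrow> real^'d"
    and \<epsilon> K D :: real
  assumes open_domain: "open \<Omega>"
    and continuous_rho: "continuous_on \<Omega> \<rho>"
    and mu_eq: "\<mu> = density (restrict_space lborel \<Omega>) (\<lambda>x. ennreal (\<rho> x))"
    and finite_V: "finite V" and V_subset: "V \<subseteq> \<Omega>"
    and sets_M: "sets M = sets (restrict_space borel V)" and prob_M: "prob_space M"
    and measurable_T: "T \<in> restrict_space borel \<Omega> \<rightarrow>\<^sub>M restrict_space borel V"
    and distr_T: "distr \<mu> (restrict_space borel V) T = M"
    and displacement: "\<And>x. x \<in> \<Omega> \<Longrightarrow> norm (T x - x) \<le> K * \<epsilon>"
    and eps_pos: "0 < \<epsilon>" and K_pos: "0 < K" and D_pos: "0 < D"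
    and rho_lower: "\<And>x. x \<in> \<Omega> \<Longrightarrow> 1 / D \<le> \<rho> x" and rho_upper: "\<And>x. x \<in> \<Omega> \<Longrightarrow> \<rho> x \<le> D"
begin

abbreviation mass :: "real^'d \<Rightarrow> real" where
  "mass y \<equiv> measure M {y}"

text \<open>
  The function \<open>u \<circ> T\<close>, extended by zero so that it lives on the whole space and can be integrated
  against Lebesgue measure.
\<close>
definition pullback :: "(real^'d \<Rightarrow> real) \<Rightarrow> real^'d \<Rightarrow> real" where
  "pullback u x = u (T x) * indicator \<Omega> x"

lemma sets_restrict_V: "sets (restrict_space borel V) = Pow V"
proof -
  have "A \<in> sets (restrict_space borel V)" if "A \<subseteq> V" for A
  proof -
    have "A \<in> sets borel" using finite_subset[OF that finite_V] by (intro borel_closed finite_imp_closed)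
    then show ?thesis using that by (auto simp: sets_restrict_space image_iff intro!: bexI[of _ A])
  qed
  then show ?thesis by (auto simp: sets_restrict_space)
qed

lemma space_M: "space M = V"
  using sets_eq_imp_space_eq[OF sets_M] by (simp add: space_restrict_space)

lemma V_nonempty: "V \<noteq> {}"
  using prob_space.not_empty[OF prob_M] space_M by simp

lemma measurable_restrict_V: "f \<in> borel_measurable (restrict_space borel V)"
  by (rule measurableI) (auto simp: sets_restrict_V space_restrict_space)

lemma T_in_V: "x \<in> \<Omega> \<Longrightarrow> T x \<in> V"
  using measurable_space[OF measurable_T, of x] by (simp add: space_restrict_space)

lemma measurable_rho: "\<rho> \<in> borel_measurable (restrict_space borel \<Omega>)"
  by (rule borel_measurable_continuous_on_restrict[OF continuous_rho])

lemma measurable_restrict_lborel: "measurable (restrict_space lborel \<Omega>) N = measurable (restrict_space borel \<Omega>) N"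
  by (rule measurable_cong_sets) (simp_all add: sets_restrict_space)

lemma nn_integral_mu:
  assumes "g \<in> borel_measurable (restrict_space borel \<Omega>)"
  shows "(\<integral>\<^sup>+x. g x \<partial>\<mu>) = (\<integral>\<^sup>+x\<in>\<Omega>. ennreal (\<rho> x) * g x \<partial>lborel)"
proof -
  have m: "g \<in> borel_measurable (restrict_space lborel \<Omega>)" "\<rho> \<in> borel_measurable (restrict_space lborel \<Omega>)"
    using assms measurable_rho by (simp_all add: measurable_restrict_lborel)
  then show ?thesis
    unfolding mu_eq using open_domain by (subst nn_integral_density) (auto simp: nn_integral_restrict_space)
qed

lemma nn_integral_pullback:
  fixes f :: "real^'d \<Rightarrow> ennreal"
  shows "(\<integral>\<^sup>+x. f (T x) \<partial>\<mu>) = (\<Sum>y\<in>V. f y * ennreal (mass y))"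
proof -
  interpret M: prob_space M by (rule prob_M)
  have fm: "f \<in> borel_measurable (restrict_space borel V)" by (rule measurable_restrict_V)
  have "T \<in> \<mu> \<rightarrow>\<^sub>M restrict_space borel V"
    using measurable_T by (simp add: mu_eq measurable_restrict_lborel)
  then have "(\<integral>\<^sup>+x. f (T x) \<partial>\<mu>) = (\<integral>\<^sup>+y. f y \<partial>distr \<mu> (restrict_space borel V) T)"
    using fm by (subst nn_integral_distr) auto
  also have "\<dots> = (\<integral>\<^sup>+y. f y \<partial>M)" by (simp add: distr_T)
  also have "\<dots> = (\<integral>\<^sup>+y. f y * indicator V y \<partial>M)"
    by (intro nn_integral_cong) (simp add: space_M)
  also have "\<dots> = (\<Sum>y\<in>V. f y * emeasure M {y})"
    by (rule nn_integral_indicator_finite) (auto simp: finite_V sets_M sets_restrict_V)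
  finally show ?thesis by (simp add: M.emeasure_eq_measure)
qed

lemma measurable_comp_T:
  "(\<lambda>x. f (T x)) \<in> borel_measurable (restrict_space borel \<Omega>)"
  using measurable_compose[OF measurable_T measurable_restrict_V] .

text \<open>
  Where the density is at least \<open>1 / D\<close>, Lebesgue measure is at most \<open>D\<close> times \<open>\<mu>\<close>, and \<open>\<mu>\<close> is
  transported to \<open>M\<close>. This turns integrals over \<open>\<Omega>\<close> into sums over the graph.
\<close>
lemma nn_integral_pullback_le:
  fixes f :: "real^'d \<Rightarrow> ennreal"
  shows "(\<integral>\<^sup>+x\<in>\<Omega>. f (T x) \<partial>lborel) \<le> ennreal D * (\<Sum>y\<in>V. f y * ennreal (mass y))"
proof -
  have "(\<lambda>x. f (T x)) \<in> borel_measurable (restrict_space lborel \<Omega>)"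
    "\<rho> \<in> borel_measurable (restrict_space lborel \<Omega>)"
    using measurable_comp_T measurable_rho by (simp_all add: measurable_restrict_lborel)
  then have "(\<lambda>x. ennreal (\<rho> x) * f (T x)) \<in> borel_measurable (restrict_space lborel \<Omega>)" by measurable
  then have [measurable]: "(\<lambda>x. ennreal (\<rho> x) * f (T x) * indicator \<Omega> x) \<in> borel_measurable borel"
    using open_domain by (subst (asm) borel_measurable_restrict_space_iff_ennreal) auto
  have "f (T x) \<le> ennreal D * (ennreal (\<rho> x) * f (T x))" if "x \<in> \<Omega>" for x
  proof -
    have "1 \<le> ennreal D * ennreal (\<rho> x)"
      using rho_lower[OF that] D_pos by (simp add: ennreal_mult'[symmetric] field_simps flip: ennreal_1)
    from mult_right_mono[OF this, of "f (T x)"] show ?thesis by (simp add: mult.assoc)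
  qed
  then have "(\<integral>\<^sup>+x\<in>\<Omega>. f (T x) \<partial>lborel) \<le> (\<integral>\<^sup>+x. ennreal D * (ennreal (\<rho> x) * f (T x) * indicator \<Omega> x) \<partial>lborel)"
    by (intro nn_integral_mono) (auto simp: indicator_def)
  also have "\<dots> = ennreal D * (\<integral>\<^sup>+x\<in>\<Omega>. ennreal (\<rho> x) * f (T x) \<partial>lborel)"
    by (rule nn_integral_cmult) simp
  also have "\<dots> = ennreal D * (\<Sum>y\<in>V. f y * ennreal (mass y))"
    by (subst nn_integral_pullback[symmetric], subst nn_integral_mu[OF measurable_comp_T]) (rule refl)
  finally show ?thesis .
qed

text \<open>
  The mass of a ball is the \<open>\<mu>\<close>-measure of its preimage under \<open>T\<close>, which lies in a ball whose radius is
  larger by the displacement.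
\<close>
lemma mass_ball_le:
  assumes "0 \<le> r"
  shows "(\<Sum>y\<in>{y\<in>V. norm (x - y) < r}. mass y) \<le> D * unit_ball_vol CARD('d) * (r + K * \<epsilon>) ^ CARD('d)"
proof -
  let ?f = "indicator (ball x r) :: real^'d \<Rightarrow> ennreal"
  have "ennreal (\<Sum>y\<in>{y\<in>V. norm (x - y) < r}. mass y) = (\<Sum>y\<in>V. ?f y * ennreal (mass y))"
  proof -
    have "(\<Sum>y\<in>V. ?f y * ennreal (mass y)) = (\<Sum>y\<in>V. ennreal (if norm (x - y) < r then mass y else 0))"
      by (intro sum.cong) (auto simp: indicator_def dist_norm)
    also have "\<dots> = ennreal (\<Sum>y\<in>V. if norm (x - y) < r then mass y else 0)" by (rule sum_ennreal) simp
    also have "(\<Sum>y\<in>V. if norm (x - y) < r then mass y else 0) = (\<Sum>y\<in>{y\<in>V. norm (x - y) < r}. mass y)"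
      by (rule sum.inter_filter[OF finite_V, symmetric])
    finally show ?thesis by simp
  qed
  also have "\<dots> = (\<integral>\<^sup>+z\<in>\<Omega>. ennreal (\<rho> z) * ?f (T z) \<partial>lborel)"
    by (subst nn_integral_pullback[symmetric], subst nn_integral_mu[OF measurable_comp_T]) (rule refl)
  also have "\<dots> \<le> (\<integral>\<^sup>+z. ennreal D * indicator (ball x (r + K * \<epsilon>)) z \<partial>lborel)"
  proof (intro nn_integral_mono)
    fix z
    show "ennreal (\<rho> z) * ?f (T z) * indicator \<Omega> z \<le> ennreal D * indicator (ball x (r + K * \<epsilon>)) z"
    proof (cases "z \<in> \<Omega> \<and> T z \<in> ball x r")
      case True
      then have "dist x z < r + K * \<epsilon>"
        using displacement[of z] dist_triangle[of x z "T z"] by (simp add: dist_norm)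
      then show ?thesis using True rho_upper[of z] by (simp add: ennreal_leI)
    qed (auto simp: indicator_def)
  qed
  also have "\<dots> = ennreal D * emeasure lborel (ball x (r + K * \<epsilon>))" by (simp add: nn_integral_cmult_indicator)
  also have "\<dots> = ennreal (D * (unit_ball_vol CARD('d) * (r + K * \<epsilon>) ^ CARD('d)))"
    using assms K_pos eps_pos D_pos by (subst emeasure_ball) (simp_all add: ennreal_mult'[symmetric])
  finally show ?thesis
    using assms K_pos eps_pos D_pos by (subst (asm) ennreal_le_iff) (simp_all add: mult.assoc)
qed

lemma measurable_pullback [measurable]: "pullback u \<in> borel_measurable borel"
proof -
  have "(\<lambda>x. u (T x)) \<in> borel_measurable (restrict_space borel \<Omega>)" by (rule measurable_comp_T)
  then show ?thesis
    using open_domain unfolding pullback_def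
    by (subst (asm) borel_measurable_restrict_space_iff) (auto simp: mult.commute)
qed

lemma pullback_bounded: "\<bar>pullback u x\<bar> \<le> (\<Sum>y\<in>V. \<bar>u y\<bar>)"
proof (cases "x \<in> \<Omega>")
  case True
  then have "\<bar>u (T x)\<bar> \<le> (\<Sum>y\<in>V. \<bar>u y\<bar>)"
    by (intro member_le_sum) (auto simp: T_in_V finite_V)
  then show ?thesis using True by (simp add: pullback_def)
qed (simp add: pullback_def sum_nonneg)

lemma nn_integral_pullback_powr_le:
  assumes p: "p > 0"
  shows "(\<integral>\<^sup>+x\<in>\<Omega>. ennreal (\<bar>pullback u x\<bar> powr p) \<partial>lborel) \<le> ennreal (D * graph_Lp_norm p V M u powr p)"
proof -
  have "(\<integral>\<^sup>+x\<in>\<Omega>. ennreal (\<bar>pullback u x\<bar> powr p) \<partial>lborel) = (\<integral>\<^sup>+x\<in>\<Omega>. ennreal (\<bar>u (T x)\<bar> powr p) \<partial>lborel)"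
    by (intro nn_integral_cong) (auto simp: pullback_def indicator_def)
  also have "\<dots> \<le> ennreal D * (\<Sum>y\<in>V. ennreal (\<bar>u y\<bar> powr p) * ennreal (mass y))"
    by (rule nn_integral_pullback_le)
  also have "\<dots> = ennreal (D * (\<Sum>y\<in>V. \<bar>u y\<bar> powr p * mass y))"
    using D_pos by (simp add: ennreal_mult'[symmetric] sum_ennreal)
  also have "(\<Sum>y\<in>V. \<bar>u y\<bar> powr p * mass y) = graph_Lp_norm p V M u powr p"
    using p by (simp add: graph_Lp_norm_def powr_powr sum_nonneg)
  finally show ?thesis .
qed

end

text \<open>
  The quarter in the bound on \<open>K\<close> leaves room for the displacement of both points of a pair at distance
  at most \<open>r \<epsilon> / 2\<close>: their images remain within the range \<open>r \<epsilon>\<close> in which the kernel is at least \<open>c\<close>.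
\<close>
locale transported_kernel_graph = transported_graph \<Omega> \<rho> \<mu> V M T \<epsilon> K D
  for \<Omega> :: "(real^'d) set" and \<rho> \<mu> V M T \<epsilon> K D +
  fixes \<eta> :: "real \<Rightarrow> real" and c r :: real and p :: real
  assumes eta_nonneg: "\<And>s. 0 \<le> s \<Longrightarrow> 0 \<le> \<eta> s"
    and c_pos: "0 < c" and r_pos: "0 < r" and eta_ge: "\<And>s. 0 \<le> s \<Longrightarrow> s \<le> r \<Longrightarrow> c \<le> \<eta> s"
    and K_le: "K \<le> r / 4" and p_gt: "CARD('d) < p"
begin

abbreviation energy :: "(real^'d \<Rightarrow> real) \<Rightarrow> real" where
  "energy u \<equiv> graph_energy \<eta> p \<epsilon> V M u"

text \<open>
  The energy density of an edge, without the masses of its ends and the prefactor \<open>\<epsilon> powr - p\<close>.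
\<close>
definition bond :: "(real^'d \<Rightarrow> real) \<Rightarrow> real^'d \<Rightarrow> real^'d \<Rightarrow> real" where
  "bond u x y = scaled_kernel CARD('d) \<eta> \<epsilon> (norm (x - y)) * \<bar>u x - u y\<bar> powr p"

lemma p_pos: "p > 1" "p > 0"
  using p_gt by (auto intro: le_less_trans[of _ "real CARD('d)"])

lemma bond_nonneg: "0 \<le> bond u x y"
  unfolding bond_def scaled_kernel_def using eps_pos by (intro mult_nonneg_nonneg divide_nonneg_pos eta_nonneg) auto

lemma energy_eq: "(\<Sum>x\<in>V. \<Sum>y\<in>V. bond u x y * mass y * mass x) = \<epsilon> powr p * energy u"
  using eps_pos by (simp add: graph_energy_def bond_def mult_ac)

lemma energy_nonneg: "0 \<le> energy u"
proof -
  have "0 \<le> \<epsilon> powr p * energy u"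
    unfolding energy_eq[symmetric] by (intro sum_nonneg mult_nonneg_nonneg bond_nonneg) auto
  then show ?thesis using eps_pos by (simp add: zero_le_mult_iff)
qed

lemma short_range_powr_le_bond:
  assumes "norm (x - y) \<le> r * \<epsilon>"
  shows "\<bar>u x - u y\<bar> powr p \<le> \<epsilon> ^ CARD('d) / c * bond u x y"
proof -
  have "c \<le> \<eta> (norm (x - y) / \<epsilon>)"
    using assms eps_pos by (intro eta_ge) (auto simp: field_simps)
  then have "c * \<bar>u x - u y\<bar> powr p \<le> \<eta> (norm (x - y) / \<epsilon>) * \<bar>u x - u y\<bar> powr p"
    by (rule mult_right_mono) simp
  then show ?thesis using c_pos eps_pos by (simp add: bond_def scaled_kernel_def field_simps)
qed

text \<open>
  Each short-range pair is mapped to a pair of vertices whose kernel weight is bounded below, and both integrals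
  turn into sums over the graph at the cost of one factor \<open>D\<close> each. The bound is written as a multiple of a
  power of the range \<open>r \<epsilon> / 2\<close>, the form in which the chain of averages takes it.
\<close>
lemma nonlocal_energy_pullback_le:
  "(\<integral>\<^sup>+x\<in>\<Omega>. (\<integral>\<^sup>+y\<in>\<Omega>. ennreal (\<bar>pullback u x - pullback u y\<bar> powr p) *
      indicator {..r / 2 * \<epsilon>} (norm (x - y)) \<partial>lborel) \<partial>lborel)
   \<le> ennreal (D\<^sup>2 / (c * (r / 2) powr (p + CARD('d))) * energy u * (r / 2 * \<epsilon>) powr (p + CARD('d)))"
proof -
  define F where "F x y = ennreal (\<epsilon> ^ CARD('d) / c * bond u x y)" for x y
  have ptw: "ennreal (\<bar>pullback u x - pullback u y\<bar> powr p) * indicator {..r / 2 * \<epsilon>} (norm (x - y))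
      \<le> F (T x) (T y)" if "x \<in> \<Omega>" "y \<in> \<Omega>" for x y
  proof (cases "norm (x - y) \<le> r / 2 * \<epsilon>")
    case True
    have "norm (T x - T y) \<le> norm (T x - x) + norm (x - y) + norm (T y - y)"
      using norm_triangle_ineq[of "T x - x" "x - y"] norm_triangle_ineq4[of "T x - y" "T y - y"] by simp
    also have "\<dots> \<le> 2 * (K * \<epsilon>) + r / 2 * \<epsilon>" using displacement[OF that(1)] displacement[OF that(2)] True by simp
    also have "\<dots> \<le> r * \<epsilon>" using mult_right_mono[OF K_le, of \<epsilon>] eps_pos by linarith
    finally have "\<bar>u (T x) - u (T y)\<bar> powr p \<le> \<epsilon> ^ CARD('d) / c * bond u (T x) (T y)"
      by (rule short_range_powr_le_bond)
    then show ?thesis using True that by (simp add: F_def pullback_def ennreal_leI)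
  qed simp
  have "(\<integral>\<^sup>+x\<in>\<Omega>. (\<integral>\<^sup>+y\<in>\<Omega>. ennreal (\<bar>pullback u x - pullback u y\<bar> powr p) *
      indicator {..r / 2 * \<epsilon>} (norm (x - y)) \<partial>lborel) \<partial>lborel)
    \<le> (\<integral>\<^sup>+x\<in>\<Omega>. (\<integral>\<^sup>+y\<in>\<Omega>. F (T x) (T y) \<partial>lborel) \<partial>lborel)"
    using ptw by (intro nn_integral_mono) (auto simp: indicator_def intro!: nn_integral_mono)
  also have "\<dots> \<le> (\<integral>\<^sup>+x\<in>\<Omega>. ennreal D * (\<Sum>y\<in>V. F (T x) y * ennreal (mass y)) \<partial>lborel)"
    by (intro nn_integral_mono mult_right_mono nn_integral_pullback_le) auto
  also have "\<dots> \<le> ennreal D * (\<Sum>x\<in>V. ennreal D * (\<Sum>y\<in>V. F x y * ennreal (mass y)) * ennreal (mass x))"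
    by (rule nn_integral_pullback_le)
  also have "\<dots> = ennreal (D * (\<Sum>x\<in>V. D * (\<Sum>y\<in>V. (\<epsilon> ^ CARD('d) / c * bond u x y) * mass y) * mass x))"
    unfolding F_def using D_pos eps_pos c_pos bond_nonneg[of u]
    by (simp add: ennreal_mult'[symmetric] ennreal_mult''[symmetric] sum_ennreal sum_nonneg)
  also have "D * (\<Sum>x\<in>V. D * (\<Sum>y\<in>V. (\<epsilon> ^ CARD('d) / c * bond u x y) * mass y) * mass x)
      = D\<^sup>2 * \<epsilon> ^ CARD('d) / c * (\<Sum>x\<in>V. \<Sum>y\<in>V. bond u x y * mass y * mass x)"
    by (simp add: sum_distrib_left sum_distrib_right mult_ac power2_eq_square)
  also have "\<dots> = D\<^sup>2 / (c * (r / 2) powr (p + CARD('d))) * energy u * (r / 2 * \<epsilon>) powr (p + CARD('d))"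
    using r_pos eps_pos unfolding energy_eq powr_mult by (simp add: powr_add powr_realpow)
  finally show ?thesis .
qed

text \<open>
  For points \<open>z\<close> near the vertex \<open>x\<close>, the differences between \<open>u x\<close> and \<open>u (T z)\<close> are those of the
  edges at \<open>x\<close>. The sum over these edges is one row of the energy, which carries the factor
  \<open>mass x\<close>; division by this mass is where it appears in the denominator.
\<close>
lemma nn_integral_powr_diff_at_vertex_le:
  assumes x: "x \<in> V" and mx: "mass x > 0" and A: "A \<subseteq> \<Omega>" and near: "\<And>z. z \<in> A \<Longrightarrow> norm (z - x) \<le> r / 2 * \<epsilon>"
  shows "(\<integral>\<^sup>+z\<in>A. ennreal (\<bar>u x - pullback u z\<bar> powr p) \<partial>lborel)
    \<le> ennreal (D * \<epsilon> ^ CARD('d) * (\<epsilon> powr p / mass x) * energy u / c)"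
proof -
  define F where "F y = ennreal (\<epsilon> ^ CARD('d) / c * bond u x y)" for y
  have ptw: "ennreal (\<bar>u x - pullback u z\<bar> powr p) \<le> F (T z)" if "z \<in> A" for z
  proof -
    have z: "z \<in> \<Omega>" using that A by auto
    have "norm (x - T z) \<le> norm (T z - z) + norm (z - x)"
      using norm_triangle_ineq[of "T z - z" "z - x"] by (simp add: norm_minus_commute)
    also have "\<dots> \<le> K * \<epsilon> + r / 2 * \<epsilon>" using displacement[OF z] near[OF that] by simp
    also have "\<dots> \<le> r * \<epsilon>" using mult_right_mono[OF K_le, of \<epsilon>] eps_pos mult_pos_pos[OF r_pos eps_pos] by linarith
    finally have "\<bar>u x - u (T z)\<bar> powr p \<le> \<epsilon> ^ CARD('d) / c * bond u x (T z)"
      by (rule short_range_powr_le_bond)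
    then show ?thesis using z by (simp add: F_def pullback_def ennreal_leI)
  qed
  have "(\<integral>\<^sup>+z\<in>A. ennreal (\<bar>u x - pullback u z\<bar> powr p) \<partial>lborel) \<le> (\<integral>\<^sup>+z\<in>\<Omega>. F (T z) \<partial>lborel)"
    using ptw A by (intro nn_integral_mono) (auto simp: indicator_def)
  also have "\<dots> \<le> ennreal D * (\<Sum>y\<in>V. F y * ennreal (mass y))" by (rule nn_integral_pullback_le)
  also have "\<dots> = ennreal (D * (\<Sum>y\<in>V. (\<epsilon> ^ CARD('d) / c * bond u x y) * mass y))"
    unfolding F_def using D_pos eps_pos c_pos bond_nonneg[of u]
    by (simp add: ennreal_mult'[symmetric] ennreal_mult''[symmetric] sum_ennreal sum_nonneg)
  also have "\<dots> = ennreal (D * \<epsilon> ^ CARD('d) / c * (\<Sum>y\<in>V. bond u x y * mass y))"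
    by (simp add: sum_distrib_left mult_ac)
  also have "\<dots> \<le> ennreal (D * \<epsilon> ^ CARD('d) / c * (\<epsilon> powr p * energy u / mass x))"
  proof (intro ennreal_leI mult_left_mono)
    have "(\<Sum>y\<in>V. bond u x y * mass y * mass x) \<le> (\<Sum>x\<in>V. \<Sum>y\<in>V. bond u x y * mass y * mass x)"
      using x by (intro member_le_sum[of x V "\<lambda>x. \<Sum>y\<in>V. bond u x y * mass y * mass x"])
        (auto intro!: sum_nonneg mult_nonneg_nonneg bond_nonneg simp: finite_V)
    then have "(\<Sum>y\<in>V. bond u x y * mass y) * mass x \<le> \<epsilon> powr p * energy u"
      unfolding energy_eq by (simp add: sum_distrib_right)
    then show "(\<Sum>y\<in>V. bond u x y * mass y) \<le> \<epsilon> powr p * energy u / mass x"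
      using mx by (simp add: field_simps)
  qed (use D_pos eps_pos c_pos in auto)
  finally show ?thesis by (simp add: mult_ac)
qed

end

section \<open>The Sobolev bound at a vertex\<close>

text \<open>
  The constant of \<open>cone_average_chain\<close> in dimension \<open>d\<close>: the numerator belongs to a single halving, and
  the denominator comes from the geometric series with ratio \<open>(1 / 2) powr (1 - d / p)\<close>.
\<close>
definition chain_const :: "nat \<Rightarrow> real \<Rightarrow> real \<Rightarrow> real" where
  "chain_const d p q = (8 powr (p + d) * 2 ^ d / (unit_ball_vol d * q ^ d)\<^sup>2) powr (1 / p) / (1 - (1 / 2) powr ((p - d) / p))"

text \<open>
  The three summands belong to the average over the largest cone, to the chain of averages, and to
  the comparison at the scale \<open>\<epsilon>\<close>. There, \<open>\<Gamma>\<close> bounds \<open>\<epsilon> powr p\<close> divided by the mass of the vertex,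
  and \<open>\<kappa> \<epsilon>\<close> is a lower bound for the height of the smallest cone.
\<close>
definition sobolev_const :: "nat \<Rightarrow> real \<Rightarrow> real \<Rightarrow> real \<Rightarrow> real \<Rightarrow> real \<Rightarrow> real \<Rightarrow> real \<Rightarrow> real" where
  "sobolev_const d p q r c D \<kappa> \<Gamma> =
     (D / (unit_ball_vol d * (q * q) ^ d)) powr (1 / p) +
     chain_const d p q * (D\<^sup>2 / (c * (r / 2) powr (p + d))) powr (1 / p) +
     (D * \<Gamma> / (c * unit_ball_vol d * (\<kappa> * q) ^ d)) powr (1 / p)"

lemma le_powr_inverse_of_ennreal_bound:
  assumes "ennreal (X powr p) * m \<le> ennreal R" "ennreal w \<le> m" "0 < w" "0 \<le> R" "0 \<le> X" "0 < p"
  shows "X \<le> (R / w) powr (1 / p)"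
proof -
  have "ennreal (X powr p * w) = ennreal (X powr p) * ennreal w" using assms by (simp add: ennreal_mult)
  also have "\<dots> \<le> ennreal (X powr p) * m" using assms by (intro mult_left_mono) auto
  also have "\<dots> \<le> ennreal R" by fact
  finally have "X powr p * w \<le> R" using assms by (subst (asm) ennreal_le_iff) auto
  then have "X powr p \<le> R / w" using assms by (simp add: field_simps)
  then have "(X powr p) powr (1 / p) \<le> (R / w) powr (1 / p)" using assms by (intro powr_mono2) auto
  then show ?thesis using assms by (simp add: powr_powr)
qed

text \<open>
  The least \<open>k\<close> for which the first inequality holds satisfies the second one. If \<open>q\<close> is small from
  the start then \<open>k = 0\<close>, which covers graphs with a large \<open>\<epsilon>\<close> together with all others.
\<close>
lemma halving_reaches_scale:
  fixes q b :: real
  assumes "0 < q" "0 < b"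
  obtains k where "q / 2 ^ k \<le> 2 * b" "k = 0 \<or> b < q / 2 ^ k"
proof -
  define P where "P k \<longleftrightarrow> q / 2 ^ k \<le> 2 * b" for k :: nat
  obtain n where "q / (2 * b) < 2 ^ n" using real_arch_pow[of 2 "q / (2 * b)"] by auto
  then have "P n" using assms by (simp add: P_def field_simps)
  define k where "k = (LEAST k. P k)"
  have "P k" using \<open>P n\<close> unfolding k_def by (rule LeastI)
  moreover have "k = 0 \<or> b < q / 2 ^ k"
  proof (cases k)
    case (Suc j)
    then have "\<not> P j" using not_less_Least[of j P] by (simp add: k_def)
    then show ?thesis unfolding Suc P_def by (simp add: field_simps)
  qed simp
  ultimately show ?thesis using that unfolding P_def by blast
qed

context transported_kernel_graph
begin

text \<open>
  The value at \<open>x\<close> is compared with the average over a cone of height about \<open>r \<epsilon> / 4\<close> and tip \<open>x\<close>,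
  this average with the one over the largest cone, and the latter with the norm of \<open>u\<close>. The parameter
  \<open>\<kappa>\<close> takes care of both outcomes for the smallest height \<open>s\<close>: either \<open>s > r \<epsilon> / 8\<close> or \<open>s = q\<close>.
\<close>
lemma vertex_sobolev_bound:
  assumes x: "x \<in> V" and mx: "mass x > 0" and \<Gamma>: "\<epsilon> powr p / mass x \<le> \<Gamma>"
    and q: "0 < q" "q \<le> 1" and e: "norm e = 1" and cone: "truncated_cone x e q q \<subseteq> \<Omega>"
    and \<kappa>: "0 < \<kappa>" "\<kappa> \<le> r / 8" "\<kappa> * \<epsilon> \<le> q"
  shows "\<bar>u x\<bar> \<le> sobolev_const CARD('d) p q r c D \<kappa> \<Gamma> * (graph_Lp_norm p V M u + energy u powr (1 / p))"
proof -
  let ?d = "CARD('d)"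
  define \<omega> where "\<omega> = unit_ball_vol ?d"
  have \<omega>: "\<omega> > 0" by (simp add: \<omega>_def)
  define v where "v = pullback u"
  have [measurable]: "v \<in> borel_measurable borel" unfolding v_def by (rule measurable_pullback)
  have bnd: "\<bar>v z\<bar> \<le> (\<Sum>y\<in>V. \<bar>u y\<bar>)" for z unfolding v_def by (rule pullback_bounded)
  define C where "C s = truncated_cone x e q s" for s
  have Cb [measurable]: "C s \<in> sets borel" for s by (simp add: C_def open_truncated_cone)
  have mC: "emeasure lborel (C s) \<ge> ennreal (\<omega> * (s * q) ^ ?d)" "emeasure lborel (C s) < \<infinity>"
      "emeasure lborel (C s) > 0" if "0 < s" for s
    using emeasure_truncated_cone[OF e q that, of x] by (simp_all add: C_def \<omega>_def)
  have \<epsilon>r: "0 < r / 8 * \<epsilon>" using r_pos eps_pos by simp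
  obtain k where k: "q / 2 ^ k \<le> 2 * (r / 8 * \<epsilon>)" "k = 0 \<or> r / 8 * \<epsilon> < q / 2 ^ k"
    using halving_reaches_scale[OF q(1) \<epsilon>r] by blast
  define s where "s = q / 2 ^ k"
  have s: "0 < s" "s \<le> q" using q by (auto simp: s_def field_simps)
  have s_low: "\<kappa> * \<epsilon> \<le> s"
  proof (cases "k = 0")
    case False
    then have "r / 8 * \<epsilon> < s" using k(2) by (simp add: s_def)
    then show ?thesis using mult_right_mono[OF \<kappa>(2), of \<epsilon>] eps_pos by linarith
  qed (use \<kappa> in \<open>simp add: s_def\<close>)
  have sub: "C s \<subseteq> \<Omega>" using truncated_cone_mono[of q q s q x e] s cone by (auto simp: C_def)
  define g where "g = energy u"
  have g: "g \<ge> 0" unfolding g_def by (rule energy_nonneg)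
  define L where "L = graph_Lp_norm p V M u"
  have L: "L \<ge> 0" by (simp add: L_def graph_Lp_norm_def)
  have \<Gamma>0: "\<Gamma> \<ge> 0" using \<Gamma> mx by (intro order_trans[OF _ \<Gamma>]) auto

  have "\<bar>0 - set_average (C q) v\<bar> \<le> (D * L powr p / (\<omega> * (q * q) ^ ?d)) powr (1 / p)"
  proof (rule le_powr_inverse_of_ennreal_bound)
    have "ennreal (\<bar>0 - set_average (C q) v\<bar> powr p) * emeasure lborel (C q)
        \<le> (\<integral>\<^sup>+z\<in>C q. ennreal (\<bar>0 - v z\<bar> powr p) \<partial>lborel)"
      using p_pos q by (intro powr_dist_set_average_le[OF _ _ _ mC(3,2) bnd]) auto
    also have "\<dots> \<le> (\<integral>\<^sup>+z\<in>\<Omega>. ennreal (\<bar>v z\<bar> powr p) \<partial>lborel)"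
      using cone by (intro nn_integral_mono) (auto simp: indicator_def C_def)
    also have "\<dots> \<le> ennreal (D * L powr p)"
      unfolding v_def L_def by (rule nn_integral_pullback_powr_le) (rule p_pos)
    finally show "ennreal (\<bar>0 - set_average (C q) v\<bar> powr p) * emeasure lborel (C q) \<le> ennreal (D * L powr p)" .
    show "ennreal (\<omega> * (q * q) ^ ?d) \<le> emeasure lborel (C q)" by (rule mC(1)[OF q(1)])
  qed (use \<omega> q D_pos p_pos in auto)
  also have "\<dots> = (D / (\<omega> * (q * q) ^ ?d)) powr (1 / p) * L"
    using L p_pos powr_mult[of "D / (\<omega> * (q * q) ^ ?d)" "L powr p" "1 / p"] by (simp add: powr_powr)
  finally have 1: "\<bar>set_average (C q) v\<bar> \<le> (D / (\<omega> * (q * q) ^ ?d)) powr (1 / p) * L" by simp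

  have "\<bar>set_average (C q) v - set_average (C s) v\<bar>
      \<le> chain_const ?d p q * (D\<^sup>2 / (c * (r / 2) powr (p + ?d)) * g) powr (1 / p)"
    unfolding C_def s_def chain_const_def
  proof (rule cone_average_chain[where 'a="real^'d" and l="r / 2 * \<epsilon>", simplified DIM_cart DIM_real mult_1_right, OF _ q e cone _ _ bnd])
    show "(\<integral>\<^sup>+x\<in>\<Omega>. (\<integral>\<^sup>+y\<in>\<Omega>. ennreal (\<bar>v x - v y\<bar> powr p) * indicator {..r / 2 * \<epsilon>} (norm (x - y)) \<partial>lborel) \<partial>lborel)
      \<le> ennreal (D\<^sup>2 / (c * (r / 2) powr (p + ?d)) * g * (r / 2 * \<epsilon>) powr (p + ?d))"
      unfolding v_def g_def by (rule nonlocal_energy_pullback_le)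
    show "k = 0 \<or> r / 2 * \<epsilon> \<le> 8 * (q / 2 ^ k)" using k(2) s(1) by (auto simp: s_def)
  qed (use p_gt open_domain r_pos eps_pos g c_pos in auto)
  also have "\<dots> = chain_const ?d p q * (D\<^sup>2 / (c * (r / 2) powr (p + ?d))) powr (1 / p) * g powr (1 / p)"
    by (simp only: powr_mult mult.assoc)
  finally have 2: "\<bar>set_average (C q) v - set_average (C s) v\<bar>
    \<le> chain_const ?d p q * (D\<^sup>2 / (c * (r / 2) powr (p + ?d))) powr (1 / p) * g powr (1 / p)" .

  have "\<bar>u x - set_average (C s) v\<bar>
      \<le> (D * \<epsilon> ^ ?d * (\<epsilon> powr p / mass x) * g / c / (\<omega> * (s * q) ^ ?d)) powr (1 / p)"
  proof (rule le_powr_inverse_of_ennreal_bound)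
    have "ennreal (\<bar>u x - set_average (C s) v\<bar> powr p) * emeasure lborel (C s)
        \<le> (\<integral>\<^sup>+z\<in>C s. ennreal (\<bar>u x - v z\<bar> powr p) \<partial>lborel)"
      using p_pos s by (intro powr_dist_set_average_le[OF _ _ _ mC(3,2) bnd]) auto
    also have "\<dots> \<le> ennreal (D * \<epsilon> ^ ?d * (\<epsilon> powr p / mass x) * g / c)"
      unfolding v_def g_def
    proof (rule nn_integral_powr_diff_at_vertex_le[OF x mx sub])
      fix z assume "z \<in> C s"
      then have "norm (z - x) \<le> 2 * s" unfolding C_def by (rule norm_diff_truncated_cone_le[OF e q(2)])
      then show "norm (z - x) \<le> r / 2 * \<epsilon>" using k(1) unfolding s_def by linarith
    qed
    finally show "ennreal (\<bar>u x - set_average (C s) v\<bar> powr p) * emeasure lborel (C s)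
      \<le> ennreal (D * \<epsilon> ^ ?d * (\<epsilon> powr p / mass x) * g / c)" .
    show "ennreal (\<omega> * (s * q) ^ ?d) \<le> emeasure lborel (C s)" by (rule mC(1)[OF s(1)])
  qed (use \<omega> q s D_pos p_pos eps_pos g c_pos in auto)
  also have "\<dots> \<le> (D * \<epsilon> ^ ?d * \<Gamma> * g / c / (\<omega> * (\<kappa> * \<epsilon> * q) ^ ?d)) powr (1 / p)"
  proof (intro powr_mono2 frac_le mult_left_mono mult_right_mono divide_right_mono power_mono \<Gamma> s_low)
  qed (use \<omega> q s D_pos p_pos eps_pos g c_pos \<kappa> \<Gamma>0 mx in auto)
  also have "D * \<epsilon> ^ ?d * \<Gamma> * g / c / (\<omega> * (\<kappa> * \<epsilon> * q) ^ ?d) = D * \<Gamma> / (c * \<omega> * (\<kappa> * q) ^ ?d) * g"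
    using eps_pos by (simp add: power_mult_distrib field_simps)
  also have "\<dots> powr (1 / p) = (D * \<Gamma> / (c * \<omega> * (\<kappa> * q) ^ ?d)) powr (1 / p) * g powr (1 / p)"
    by (rule powr_mult)
  finally have 3: "\<bar>u x - set_average (C s) v\<bar>
    \<le> (D * \<Gamma> / (c * \<omega> * (\<kappa> * q) ^ ?d)) powr (1 / p) * g powr (1 / p)" .

  define c1 where "c1 = (D / (\<omega> * (q * q) ^ ?d)) powr (1 / p)"
  define c2 where "c2 = chain_const ?d p q * (D\<^sup>2 / (c * (r / 2) powr (p + ?d))) powr (1 / p)"
  define c3 where "c3 = (D * \<Gamma> / (c * \<omega> * (\<kappa> * q) ^ ?d)) powr (1 / p)"
  have "(1 / 2 :: real) powr ((p - ?d) / p) \<le> 1" using p_gt p_pos by (intro powr_le1) auto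
  then have "chain_const ?d p q \<ge> 0" unfolding chain_const_def by (intro divide_nonneg_nonneg) auto
  then have cs: "c1 \<ge> 0" "c2 \<ge> 0" "c3 \<ge> 0" by (auto simp: c1_def c2_def c3_def)
  have "\<bar>u x\<bar> \<le> c1 * L + c2 * g powr (1 / p) + c3 * g powr (1 / p)"
    using 1 2 3 unfolding c1_def c2_def c3_def by linarith
  also have "\<dots> \<le> (c1 + c2 + c3) * (L + g powr (1 / p))"
    using mult_nonneg_nonneg[OF cs(1), of "g powr (1 / p)"] mult_nonneg_nonneg[OF cs(2) L]
      mult_nonneg_nonneg[OF cs(3) L] by (simp add: algebra_simps)
  also have "c1 + c2 + c3 = sobolev_const ?d p q r c D \<kappa> \<Gamma>"
    by (simp add: sobolev_const_def c1_def c2_def c3_def \<omega>_def)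
  finally show ?thesis by (simp add: L_def g_def)
qed

end

section \<open>Kernels of finite moment and the energy of indicator functions\<close>

text \<open>
  By monotonicity, the moment integral over \<open>[s / 2, s]\<close> alone is at least
  \<open>\<eta> s * (s / 2) powr (d + t)\<close>.
\<close>
lemma kernel_decay:
  assumes nonneg: "\<forall>s\<ge>0. 0 \<le> \<eta> s" and mono: "antimono_on {0..} \<eta>" and t: "t \<ge> 0"
    and fin: "kernel_moment d \<eta> t < \<infinity>" and d: "d \<ge> 1"
  obtains C where "\<And>s. s > 0 \<Longrightarrow> \<eta> s \<le> C * s powr - (real d + t)"
proof -
  define I where "I = enn2real (kernel_moment d \<eta> t)"
  have I: "kernel_moment d \<eta> t = ennreal I" using fin by (simp add: I_def)
  have "\<eta> s \<le> (2 powr (d + t) * I) * s powr - (real d + t)" if s: "s > 0" for s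
  proof -
    have "ennreal (\<eta> s * (s / 2) powr (d + t)) = ennreal (\<eta> s * (s / 2) powr (d + t - 1)) * ennreal (s / 2)"
      using s nonneg powr_add[of "s / 2" "d + t - 1" 1] by (simp add: ennreal_mult[symmetric] mult.assoc)
    also have "\<dots> = (\<integral>\<^sup>+r. ennreal (\<eta> s * (s / 2) powr (d + t - 1)) * indicator {s / 2..s} r \<partial>lborel)"
      using s by (simp add: nn_integral_cmult_indicator)
    also have "\<dots> \<le> kernel_moment d \<eta> t"
      unfolding kernel_moment_def
    proof (intro nn_integral_mono)
      fix r
      show "ennreal (\<eta> s * (s / 2) powr (d + t - 1)) * indicator {s / 2..s} r
          \<le> ennreal (\<eta> r * r powr (d + t - 1)) * indicator {0..} r"
      proof (cases "r \<in> {s / 2..s}")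
        case True
        then have "\<eta> s \<le> \<eta> r" using s by (intro monotone_onD[OF mono]) auto
        moreover have "(s / 2) powr (d + t - 1) \<le> r powr (d + t - 1)"
          using True s t d by (intro powr_mono2) auto
        ultimately have "\<eta> s * (s / 2) powr (d + t - 1) \<le> \<eta> r * r powr (d + t - 1)"
          using s nonneg True by (intro mult_mono) auto
        then show ?thesis using True s by (simp add: ennreal_leI)
      qed simp
    qed
    finally have "\<eta> s * (s / 2) powr (d + t) \<le> I" unfolding I by (subst (asm) ennreal_le_iff) (simp_all add: I_def)
    then have "\<eta> s \<le> (2 powr (d + t) * I) * (1 / s powr (d + t))"
      using s by (simp add: powr_divide field_simps)
    then show ?thesis by (simp only: powr_minus_divide)
  qed
  then show ?thesis using that by blast
qed

text \<open>
  The kernel decays like \<open>k powr - (d + t)\<close> and the other factor is of order \<open>k ^ d\<close>, so the terms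
  are at most of order \<open>k powr - t\<close>. The first term is left out of the comparison because the decay estimate
  is void at zero.
\<close>
lemma summable_kernel_shells:
  assumes nonneg: "\<forall>s\<ge>0. 0 \<le> \<eta> s" and mono: "antimono_on {0..} \<eta>" and t: "t > 1"
    and fin: "kernel_moment d \<eta> t < \<infinity>" and d: "d \<ge> 1" and K: "K \<ge> 0"
  shows "summable (\<lambda>k. \<eta> (real k) * (real k + 1 + K) ^ d)"
proof -
  obtain C where C: "\<And>s. s > 0 \<Longrightarrow> \<eta> s \<le> C * s powr - (real d + t)"
    using kernel_decay[OF nonneg mono _ fin d] t by auto
  have "summable (\<lambda>k. C * (2 + K) ^ d * real k powr - t)"
    using t by (intro summable_mult) (simp add: summable_real_powr_iff)
  then show ?thesis
  proof (rule summable_comparison_test'[where N=1])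
    fix k :: nat assume k: "k \<ge> 1"
    have shell: "(real k + 1 + K) ^ d \<le> ((2 + K) * real k) ^ d"
    proof (intro power_mono)
      have "K * 1 \<le> K * real k" using k K by (intro mult_left_mono) auto
      then show "real k + 1 + K \<le> (2 + K) * real k" using k by (simp add: distrib_right)
    qed (use K in auto)
    have "\<eta> (real k) * (real k + 1 + K) ^ d \<le> (C * real k powr - (real d + t)) * ((2 + K) * real k) ^ d"
    proof (rule mult_mono)
      show "\<eta> (real k) \<le> C * real k powr - (real d + t)" using C[of "real k"] k by simp
      moreover have "0 \<le> \<eta> (real k)" using nonneg by simp
      ultimately show "0 \<le> C * real k powr - (real d + t)" by linarith
    qed (use K shell in auto)
    also have "\<dots> = C * (2 + K) ^ d * real k powr - t"
    proof -
      have "real k powr - (real d + t) * real k ^ d = real k powr (- (real d + t) + real d)"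
        using k by (subst powr_add) (simp add: powr_realpow)
      then show ?thesis by (simp add: power_mult_distrib)
    qed
    finally show "norm (\<eta> (real k) * (real k + 1 + K) ^ d) \<le> C * (2 + K) ^ d * real k powr - t"
      using nonneg K by simp
  qed
qed

context transported_graph
begin

text \<open>
  The weighted degree of a point is bounded independently of the graph. The vertices are grouped into
  shells of width \<open>\<epsilon>\<close> around \<open>x\<close>; on the \<open>k\<close>-th shell the kernel is at most \<open>\<eta> k / \<epsilon> ^ d\<close>, and the mass
  of the shell is at most that of a ball of radius \<open>(k + 1) \<epsilon>\<close>. The powers of \<open>\<epsilon>\<close> cancel.
\<close>
lemma kernel_row_sum_le:
  assumes nonneg: "\<forall>s\<ge>0. 0 \<le> \<eta> s" and mono: "antimono_on {0..} \<eta>"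
    and summable: "summable (\<lambda>k. \<eta> (real k) * (real k + 1 + K) ^ CARD('d))"
  shows "(\<Sum>y\<in>V. scaled_kernel CARD('d) \<eta> \<epsilon> (norm (x - y)) * mass y)
    \<le> D * unit_ball_vol CARD('d) * (\<Sum>k. \<eta> (real k) * (real k + 1 + K) ^ CARD('d))"
proof -
  let ?d = "CARD('d)" and ?\<omega> = "unit_ball_vol CARD('d)"
  define shell where "shell y = nat \<lfloor>norm (x - y) / \<epsilon>\<rfloor>" for y
  have shell: "real (shell y) \<le> norm (x - y) / \<epsilon>" "norm (x - y) / \<epsilon> < real (shell y) + 1" for y
    using eps_pos by (simp_all add: shell_def)
  have "(\<Sum>y\<in>V. scaled_kernel ?d \<eta> \<epsilon> (norm (x - y)) * mass y) \<le> (\<Sum>y\<in>V. \<eta> (shell y) / \<epsilon> ^ ?d * mass y)"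
    unfolding scaled_kernel_def using eps_pos
    by (intro sum_mono mult_right_mono divide_right_mono monotone_onD[OF mono]) (auto simp: shell)
  also have "\<dots> = (\<Sum>k\<in>shell ` V. \<Sum>y | y \<in> V \<and> shell y = k. \<eta> (shell y) / \<epsilon> ^ ?d * mass y)"
    by (rule sum.image_gen[OF finite_V])
  also have "\<dots> \<le> (\<Sum>k\<in>shell ` V. D * ?\<omega> * (\<eta> (real k) * (real k + 1 + K) ^ ?d))"
  proof (rule sum_mono)
    fix k
    have "(\<Sum>y | y \<in> V \<and> shell y = k. mass y) \<le> (\<Sum>y\<in>{y\<in>V. norm (x - y) < (real k + 1) * \<epsilon>}. mass y)"
      using shell(2) eps_pos finite_V by (intro sum_mono2) (auto simp: field_simps)
    also have "\<dots> \<le> D * ?\<omega> * ((real k + 1) * \<epsilon> + K * \<epsilon>) ^ ?d"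
      using eps_pos by (intro mass_ball_le) auto
    also have "\<dots> = D * ?\<omega> * (real k + 1 + K) ^ ?d * \<epsilon> ^ ?d"
      by (simp add: power_mult_distrib[symmetric] algebra_simps)
    finally have "\<eta> (real k) / \<epsilon> ^ ?d * (\<Sum>y | y \<in> V \<and> shell y = k. mass y)
        \<le> \<eta> (real k) / \<epsilon> ^ ?d * (D * ?\<omega> * (real k + 1 + K) ^ ?d * \<epsilon> ^ ?d)"
      using nonneg eps_pos by (intro mult_left_mono) auto
    then show "(\<Sum>y | y \<in> V \<and> shell y = k. \<eta> (shell y) / \<epsilon> ^ ?d * mass y)
        \<le> D * ?\<omega> * (\<eta> (real k) * (real k + 1 + K) ^ ?d)"
      using eps_pos by (simp add: sum_distrib_left mult_ac)
  qed
  also have "\<dots> = D * ?\<omega> * (\<Sum>k\<in>shell ` V. \<eta> (real k) * (real k + 1 + K) ^ ?d)"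
    by (simp add: sum_distrib_left)
  also have "\<dots> \<le> D * ?\<omega> * (\<Sum>k. \<eta> (real k) * (real k + 1 + K) ^ ?d)"
    using nonneg K_pos D_pos finite_V by (intro mult_left_mono sum_le_suminf[OF summable]) auto
  finally show ?thesis .
qed

text \<open>
  Only edges at \<open>x\<close> contribute, each of them in both orientations, hence the factor 2.
\<close>
lemma graph_energy_indicator_le:
  assumes nonneg: "\<forall>s\<ge>0. 0 \<le> \<eta> s" and p: "p > 0" and x: "x \<in> V"
    and row: "(\<Sum>y\<in>V. scaled_kernel CARD('d) \<eta> \<epsilon> (norm (x - y)) * mass y) \<le> B"
  shows "graph_energy \<eta> p \<epsilon> V M (indicator {x}) \<le> 2 * B * mass x / \<epsilon> powr p"
proof -
  let ?k = "\<lambda>y z. scaled_kernel CARD('d) \<eta> \<epsilon> (norm (y - z))"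
  have k: "0 \<le> ?k y z" for y z using nonneg eps_pos by (simp add: scaled_kernel_def)
  have "(\<Sum>y\<in>V. \<Sum>z\<in>V. ?k y z * \<bar>indicator {x} y - indicator {x} z\<bar> powr p * mass y * mass z)
    \<le> (\<Sum>y\<in>V. \<Sum>z\<in>V. ?k y z * (indicator {x} y + indicator {x} z) * mass y * mass z)"
    using p by (intro sum_mono mult_right_mono mult_left_mono k) (auto simp: indicator_def)
  also have "\<dots> = (\<Sum>y\<in>V. \<Sum>z\<in>V. indicator {x} y * (?k y z * mass y * mass z))
      + (\<Sum>z\<in>V. \<Sum>y\<in>V. indicator {x} z * (?k y z * mass y * mass z))"
    by (subst (3) sum.swap) (simp add: sum.distrib[symmetric] algebra_simps)
  also have "\<dots> = mass x * (\<Sum>z\<in>V. ?k x z * mass z) + mass x * (\<Sum>y\<in>V. ?k x y * mass y)"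
    using finite_V x
    by (simp add: sum_distrib_left[symmetric] indicator_def if_distrib[of "\<lambda>a. a * _"] sum.delta
      norm_minus_commute[of x] mult_ac cong: if_cong)
  also have "\<dots> \<le> mass x * B + mass x * B" by (intro add_mono mult_left_mono row) auto
  finally show ?thesis unfolding graph_energy_def using eps_pos by (simp add: field_simps)
qed

lemma graph_Lp_norm_indicator:
  assumes "p > 0" "x \<in> V"
  shows "graph_Lp_norm p V M (indicator {x}) = mass x powr (1 / p)"
proof -
  have "(\<Sum>y\<in>V. \<bar>indicator {x} y\<bar> powr p * mass y) = (\<Sum>y\<in>V. if y = x then mass y else 0)"
    using assms by (intro sum.cong) (auto simp: indicator_def)
  then show ?thesis using assms finite_V by (simp add: graph_Lp_norm_def sum.delta)
qed

end

section \<open>Uniform graph Sobolev inequalities\<close>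

lemma kernel_lower_bound_near_zero:
  fixes \<eta> :: "real \<Rightarrow> real"
  assumes cont: "continuous (at 0 within {0..}) \<eta>" and pos: "\<eta> 0 > 0"
  obtains r where "r > 0" "\<And>s. 0 \<le> s \<Longrightarrow> s \<le> r \<Longrightarrow> \<eta> 0 / 2 \<le> \<eta> s"
proof -
  obtain d where d: "d > 0" "\<And>s. s \<in> {0..} \<Longrightarrow> dist s 0 < d \<Longrightarrow> dist (\<eta> s) (\<eta> 0) < \<eta> 0 / 2"
    using cont pos unfolding continuous_within_eps_delta by (meson half_gt_zero)
  show ?thesis
  proof (rule that[of "d / 2"])
    fix s :: real assume "0 \<le> s" "s \<le> d / 2"
    then have "dist (\<eta> s) (\<eta> 0) < \<eta> 0 / 2" using d by (intro d(2)) auto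
    then show "\<eta> 0 / 2 \<le> \<eta> s" by (simp add: dist_real_def abs_if split: if_splits)
  qed (use d in auto)
qed

text \<open>
  All parameters of the constant for a single graph can be chosen independently of \<open>n\<close>. Since the
  sequence \<open>\<epsilon>\<close> is bounded by \<open>e0\<close>, the choice of \<open>\<kappa>\<close> below satisfies \<open>\<kappa> * \<epsilon> n \<le> q\<close> for every \<open>n\<close>, also
  for the finitely many with \<open>\<epsilon> n\<close> large compared to \<open>\<Omega>\<close>.
\<close>
lemma uniform_graph_sobolev_if_mass_lower_bound:
  fixes \<Omega> :: "(real^'d) set"
  assumes graph: "\<And>n. n \<ge> 1 \<Longrightarrow> transported_kernel_graph \<Omega> \<rho> \<mu> (V n) (\<mu>V n) (T n) (\<epsilon> n) K D \<eta> c r p"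
    and q: "0 < q" "q \<le> 1"
    and cone: "\<And>x. x \<in> \<Omega> \<Longrightarrow> \<exists>e. norm e = 1 \<and> truncated_cone x e q q \<subseteq> \<Omega>"
    and e0: "0 < e0" "\<And>n. \<epsilon> n \<le> e0"
    and mass: "\<And>n x. n \<ge> 1 \<Longrightarrow> x \<in> V n \<Longrightarrow> measure (\<mu>V n) {x} > 0 \<and> \<epsilon> n powr p / measure (\<mu>V n) {x} \<le> \<Gamma>"
  shows "uniform_graph_sobolev \<eta> p \<epsilon> V \<mu>V"
proof -
  have r: "0 < r" using graph[of 1] by (simp add: transported_kernel_graph_def transported_kernel_graph_axioms_def)
  define \<kappa> where "\<kappa> = min (r / 8) (q / e0)"
  have \<kappa>: "0 < \<kappa>" "\<kappa> \<le> r / 8" "\<kappa> * e0 \<le> q" using r q e0 by (auto simp: \<kappa>_def min_def field_simps)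
  define C where "C = max 1 (sobolev_const CARD('d) p q r c D \<kappa> \<Gamma>)"
  have "(SUP x\<in>V n. \<bar>u x\<bar>) \<le>
      C * (graph_Lp_norm p (V n) (\<mu>V n) u + graph_energy \<eta> p (\<epsilon> n) (V n) (\<mu>V n) u powr (1 / p))"
    if n: "n \<ge> 1" for n and u :: "real^'d \<Rightarrow> real"
  proof -
    interpret G: transported_kernel_graph \<Omega> \<rho> \<mu> "V n" "\<mu>V n" "T n" "\<epsilon> n" K D \<eta> c r p by (rule graph[OF n])
    show ?thesis
    proof (rule cSUP_least[OF G.V_nonempty])
      fix x assume x: "x \<in> V n"
      then obtain e where e: "norm e = 1" "truncated_cone x e q q \<subseteq> \<Omega>" using cone G.V_subset by blast
      have "\<kappa> * \<epsilon> n \<le> q" using mult_left_mono[OF e0(2)[of n], of \<kappa>] \<kappa> by linarith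
      then have "\<bar>u x\<bar> \<le> sobolev_const CARD('d) p q r c D \<kappa> \<Gamma> *
          (graph_Lp_norm p (V n) (\<mu>V n) u + G.energy u powr (1 / p))"
        using mass[OF n x] by (intro G.vertex_sobolev_bound[OF x _ _ q e \<kappa>(1,2)]) auto
      also have "\<dots> \<le> C * (graph_Lp_norm p (V n) (\<mu>V n) u + G.energy u powr (1 / p))"
        by (intro mult_right_mono) (auto simp: C_def graph_Lp_norm_def)
      finally show "\<bar>u x\<bar> \<le> C * (graph_Lp_norm p (V n) (\<mu>V n) u + G.energy u powr (1 / p))" .
    qed
  qed
  moreover have "C > 0" by (simp add: C_def)
  ultimately show ?thesis unfolding uniform_graph_sobolev_def by blast
qed

text \<open>
  The indicator of a vertex has supremum 1. With \<open>N\<close> vertices of mass at most \<open>H / N\<close>, its norm is of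
  order \<open>N powr (- 1 / p)\<close> and the \<open>p\<close>-th root of its energy of order \<open>N powr (- 1 / p) / \<epsilon>\<close>.
  Multiplying the Sobolev inequality by \<open>\<epsilon> * N powr (1 / p)\<close> gives the bound.
\<close>
lemma bounded_if_uniform_graph_sobolev:
  fixes \<Omega> :: "(real^'d) set"
  assumes graph: "\<And>n. n \<ge> 1 \<Longrightarrow> transported_graph \<Omega> \<rho> \<mu> (V n) (\<mu>V n) (T n) (\<epsilon> n) K D"
    and nonneg: "\<forall>s\<ge>0. 0 \<le> \<eta> s" and mono: "antimono_on {0..} \<eta>"
    and t: "t > 1" and fin: "kernel_moment CARD('d) \<eta> t < \<infinity>" and p: "p > 0"
    and e0: "\<And>n. \<epsilon> n \<le> e0"
    and H: "0 < H" "\<And>n x. n \<ge> 1 \<Longrightarrow> x \<in> V n \<Longrightarrow> measure (\<mu>V n) {x} \<le> H / real (card (V n))"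
    and sob: "uniform_graph_sobolev \<eta> p \<epsilon> V \<mu>V"
  shows "bounded ((\<lambda>n. \<epsilon> n * real (card (V n)) powr (1 / p)) ` {1..})"
proof -
  define B where "B = D * unit_ball_vol CARD('d) * (\<Sum>k. \<eta> (real k) * (real k + 1 + K) ^ CARD('d))"
  obtain C where C: "C > 0" "\<And>n u. n \<ge> 1 \<Longrightarrow> (SUP x\<in>V n. \<bar>u x\<bar>) \<le>
      C * (graph_Lp_norm p (V n) (\<mu>V n) u + graph_energy \<eta> p (\<epsilon> n) (V n) (\<mu>V n) u powr (1 / p))"
    using sob unfolding uniform_graph_sobolev_def by blast
  have "norm (\<epsilon> n * real (card (V n)) powr (1 / p)) \<le> C * (e0 * H powr (1 / p) + (2 * B * H) powr (1 / p))"
    if n: "n \<in> {1..}" for n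
  proof -
    have n: "n \<ge> 1" using that by simp
    interpret G: transported_graph \<Omega> \<rho> \<mu> "V n" "\<mu>V n" "T n" "\<epsilon> n" K D by (rule graph[OF n])
    obtain x where x: "x \<in> V n" using G.V_nonempty by auto
    define N where "N = real (card (V n))"
    have N: "N > 0" using x G.finite_V by (auto simp: N_def card_gt_0_iff)
    let ?u = "indicator {x} :: real^'d \<Rightarrow> real"
    have m: "G.mass x \<le> H / N" using H(2)[OF n x] by (simp add: N_def)
    have row: "(\<Sum>y\<in>V n. scaled_kernel CARD('d) \<eta> (\<epsilon> n) (norm (x - y)) * G.mass y) \<le> B"
      unfolding B_def using G.K_pos
      by (intro G.kernel_row_sum_le[OF nonneg mono] summable_kernel_shells[OF nonneg mono t fin]) auto
    have "0 \<le> (\<Sum>y\<in>V n. scaled_kernel CARD('d) \<eta> (\<epsilon> n) (norm (x - y)) * G.mass y)"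
      using nonneg G.eps_pos by (intro sum_nonneg) (simp add: scaled_kernel_def)
    then have B: "0 \<le> B" using row by linarith
    have "graph_energy \<eta> p (\<epsilon> n) (V n) (\<mu>V n) ?u \<le> 2 * B * G.mass x / \<epsilon> n powr p"
      by (rule G.graph_energy_indicator_le[OF nonneg p x row])
    also have "\<dots> \<le> 2 * B * (H / N) / \<epsilon> n powr p"
      using B m by (intro divide_right_mono mult_left_mono) auto
    finally have energy: "graph_energy \<eta> p (\<epsilon> n) (V n) (\<mu>V n) ?u \<le> 2 * B * H / N / \<epsilon> n powr p" by simp
    have energy0: "0 \<le> graph_energy \<eta> p (\<epsilon> n) (V n) (\<mu>V n) ?u"
      using nonneg G.eps_pos unfolding graph_energy_def scaled_kernel_def
      by (intro mult_nonneg_nonneg sum_nonneg divide_nonneg_pos) auto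
    have "1 = \<bar>?u x\<bar>" by simp
    also have "\<dots> \<le> (SUP y\<in>V n. \<bar>?u y\<bar>)" using x G.finite_V by (intro cSUP_upper) auto
    also have "\<dots> \<le> C * (G.mass x powr (1 / p) + graph_energy \<eta> p (\<epsilon> n) (V n) (\<mu>V n) ?u powr (1 / p))"
      using C(2)[OF n, of ?u] by (simp add: G.graph_Lp_norm_indicator[OF p x])
    also have "\<dots> \<le> C * ((H / N) powr (1 / p) + (2 * B * H / N / \<epsilon> n powr p) powr (1 / p))"
      using C(1) p m energy energy0 by (intro mult_left_mono add_mono powr_mono2) auto
    also have "(2 * B * H / N / \<epsilon> n powr p) powr (1 / p) = (2 * B * H) powr (1 / p) / N powr (1 / p) / \<epsilon> n"
      unfolding powr_divide using p G.eps_pos by (simp add: powr_powr)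
    also have "(H / N) powr (1 / p) = H powr (1 / p) / N powr (1 / p)" by (rule powr_divide)
    finally have "1 * (\<epsilon> n * N powr (1 / p)) \<le>
        C * (H powr (1 / p) / N powr (1 / p) + (2 * B * H) powr (1 / p) / N powr (1 / p) / \<epsilon> n) * (\<epsilon> n * N powr (1 / p))"
      using G.eps_pos by (intro mult_right_mono) auto
    also have "\<dots> = C * (\<epsilon> n * H powr (1 / p) + (2 * B * H) powr (1 / p))"
      using N G.eps_pos by (simp add: field_simps)
    also have "\<dots> \<le> C * (e0 * H powr (1 / p) + (2 * B * H) powr (1 / p))"
      using C(1) e0[of n] by (intro mult_left_mono add_right_mono mult_right_mono) auto
    finally show ?thesis using G.eps_pos by (simp add: N_def)
  qed
  then show ?thesis unfolding bounded_iff by blast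
qed

text \<open>
  If \<open>a \<le> m \<le> b\<close> are the least mass, the mass of a vertex and the greatest mass, then
  \<open>1 / m \<le> b / a\<^sup>2\<close>.
\<close>
lemma mass_ratio_bounded_imp_mass_lower_bound:
  assumes "mass_ratio_bounded p \<epsilon> V \<mu>V" and fin: "\<And>n. n \<ge> 1 \<Longrightarrow> finite (V n)"
  obtains \<Gamma> where "\<And>n x. n \<ge> 1 \<Longrightarrow> x \<in> V n \<Longrightarrow>
    measure (\<mu>V n) {x} > 0 \<and> \<epsilon> n powr p / measure (\<mu>V n) {x} \<le> \<Gamma>"
proof -
  obtain \<Gamma> where \<Gamma>: "\<And>n. n \<ge> 1 \<Longrightarrow> \<bar>\<epsilon> n powr p * max_mass (V n) (\<mu>V n) / (min_mass (V n) (\<mu>V n))\<^sup>2\<bar> \<le> \<Gamma>"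
    and pos: "\<And>n. n \<ge> 1 \<Longrightarrow> min_mass (V n) (\<mu>V n) > 0"
    using assms(1) unfolding mass_ratio_bounded_def bounded_iff by auto
  have "measure (\<mu>V n) {x} > 0 \<and> \<epsilon> n powr p / measure (\<mu>V n) {x} \<le> \<Gamma>" if n: "n \<ge> 1" and x: "x \<in> V n" for n x
  proof -
    define a where "a = min_mass (V n) (\<mu>V n)"
    define b where "b = max_mass (V n) (\<mu>V n)"
    define m where "m = measure (\<mu>V n) {x}"
    have "a \<le> m" "m \<le> b" unfolding a_def b_def m_def min_mass_def max_mass_def using fin[OF n] x by auto
    moreover have a: "a > 0" unfolding a_def by (rule pos[OF n])
    ultimately have m: "m > 0" "1 / m \<le> b / a\<^sup>2"
    proof -
      have "a * a \<le> m * b" using \<open>a \<le> m\<close> \<open>m \<le> b\<close> a by (intro mult_mono) auto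
      then show "1 / m \<le> b / a\<^sup>2" using a \<open>a \<le> m\<close> by (simp add: field_simps power2_eq_square)
    qed (use a \<open>a \<le> m\<close> in auto)
    have "\<epsilon> n powr p / m = \<epsilon> n powr p * (1 / m)" by simp
    also have "\<dots> \<le> \<epsilon> n powr p * (b / a\<^sup>2)" using m by (intro mult_left_mono) auto
    also have "\<dots> \<le> \<Gamma>" using abs_le_D1[OF \<Gamma>[OF n]] by (simp add: a_def b_def)
    finally show ?thesis using m by (simp add: m_def)
  qed
  then show ?thesis using that by blast
qed

lemma scaled_card_bounded_imp_mass_lower_bound:
  assumes p: "p > 0" and eps: "\<And>n. n \<ge> 1 \<Longrightarrow> \<epsilon> n > 0"
    and V: "\<And>n. n \<ge> 1 \<Longrightarrow> finite (V n)" and H: "H > 0"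
    and low: "\<And>n x. n \<ge> 1 \<Longrightarrow> x \<in> V n \<Longrightarrow> 1 / (H * real (card (V n))) \<le> measure (\<mu>V n) {x}"
    and bnd: "bounded ((\<lambda>n. \<epsilon> n * real (card (V n)) powr (1 / p)) ` {1..})"
  obtains \<Gamma> where "\<And>n x. n \<ge> 1 \<Longrightarrow> x \<in> V n \<Longrightarrow>
    measure (\<mu>V n) {x} > 0 \<and> \<epsilon> n powr p / measure (\<mu>V n) {x} \<le> \<Gamma>"
proof -
  obtain B where B: "\<And>n. n \<ge> 1 \<Longrightarrow> \<bar>\<epsilon> n * real (card (V n)) powr (1 / p)\<bar> \<le> B"
    using bnd unfolding bounded_iff by auto
  have "measure (\<mu>V n) {x} > 0 \<and> \<epsilon> n powr p / measure (\<mu>V n) {x} \<le> B powr p * H" if n: "n \<ge> 1" and x: "x \<in> V n" for n x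
  proof -
    define N where "N = real (card (V n))"
    define m where "m = measure (\<mu>V n) {x}"
    have N: "N > 0" using x V[OF n] by (auto simp: N_def card_gt_0_iff)
    have m: "1 / (H * N) \<le> m" using low[OF n x] by (simp add: N_def m_def)
    have m0: "m > 0" using H N by (intro less_le_trans[OF _ m]) auto
    have "(\<epsilon> n * N powr (1 / p)) powr p \<le> B powr p"
      using B[OF n] p eps[OF n] by (intro powr_mono2) (auto simp: N_def)
    then have eN: "\<epsilon> n powr p * N \<le> B powr p" using p N by (simp add: powr_mult powr_powr)
    have "1 / m \<le> H * N" using m m0 H N by (simp add: field_simps)
    then have "\<epsilon> n powr p * (1 / m) \<le> \<epsilon> n powr p * (H * N)" by (intro mult_left_mono) auto
    also have "\<dots> = \<epsilon> n powr p * N * H" by simp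
    also have "\<dots> \<le> B powr p * H" using eN H by (intro mult_right_mono) auto
    finally have "\<epsilon> n powr p / m \<le> B powr p * H" by simp
    then show ?thesis using m0 by (simp add: m_def)
  qed
  then show ?thesis using that by blast
qed

theorem theorem5p15:
  fixes \<Omega> :: "(real^'d) set" and \<eta> :: "real \<Rightarrow> real"
  assumes "open \<Omega>" and "bounded \<Omega>" and "lipschitz_boundary \<Omega>"
    and "\<forall>r\<ge>0. \<eta> r \<ge> 0"
  shows "\<exists>S>0. \<forall>(p::real) (\<rho> :: real^'d \<Rightarrow> real) (\<mu> :: (real^'d) measure) (\<epsilon> :: nat \<Rightarrow> real)
      (V :: nat \<Rightarrow> (real^'d) set) (\<mu>V :: nat \<Rightarrow> (real^'d) measure).
    real CARD('d) < p \<longrightarrow>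
    continuous_on \<Omega> \<rho> \<longrightarrow> (\<forall>x\<in>\<Omega>. \<rho> x \<ge> 0) \<longrightarrow>
    \<mu> = density (restrict_space lborel \<Omega>) (\<lambda>x. ennreal (\<rho> x)) \<longrightarrow> prob_space \<mu> \<longrightarrow>
    (\<forall>n\<ge>1. \<epsilon> n > 0) \<longrightarrow> \<epsilon> \<longlonglongrightarrow> 0 \<longrightarrow>
    (\<forall>n\<ge>1. finite (V n) \<and> V n \<subseteq> \<Omega> \<and>
       sets (\<mu>V n) = sets (restrict_space borel (V n)) \<and> prob_space (\<mu>V n)) \<longrightarrow>
    (\<exists>K T. 0 < K \<and> K \<le> S \<and>
       (\<forall>n\<ge>1. T n \<in> restrict_space borel \<Omega> \<rightarrow>\<^sub>M restrict_space borel (V n) \<and>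
          distr \<mu> (restrict_space borel (V n)) (T n) = \<mu>V n \<and>
          (\<forall>x\<in>\<Omega>. norm (T n x - x) \<le> K * \<epsilon> n))) \<longrightarrow>
    continuous (at 0 within {0..}) \<eta> \<longrightarrow> antimono_on {0..} \<eta> \<longrightarrow> \<eta> 0 > 0 \<longrightarrow>
    (\<exists>D>0. \<forall>x\<in>\<Omega>. 1 / D \<le> \<rho> x \<and> \<rho> x \<le> D) \<longrightarrow>
    (\<exists>t>p. kernel_moment CARD('d) \<eta> t < \<infinity>) \<longrightarrow>
    (mass_ratio_bounded p \<epsilon> V \<mu>V \<longrightarrow> uniform_graph_sobolev \<eta> p \<epsilon> V \<mu>V) \<and>
    ((\<exists>D>0. \<forall>n\<ge>1. \<forall>x\<in>V n. 1 / (D * real (card (V n))) \<le> measure (\<mu>V n) {x} \<and>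
                             measure (\<mu>V n) {x} \<le> D / real (card (V n))) \<longrightarrow>
     (uniform_graph_sobolev \<eta> p \<epsilon> V \<mu>V \<longleftrightarrow>
      bounded ((\<lambda>n. \<epsilon> n * real (card (V n)) powr (1 / p)) ` {1..})))"
proof (cases "continuous (at 0 within {0..}) \<eta> \<and> \<eta> 0 > 0")
  \<comment> \<open>The hypotheses on the kernel fail, so that any positive number will do.\<close>
  case False
  then show ?thesis by (intro exI[of _ 1]) auto
next
  case True
  then obtain r where r: "r > 0" "\<And>s. 0 \<le> s \<Longrightarrow> s \<le> r \<Longrightarrow> \<eta> 0 / 2 \<le> \<eta> s"
    using kernel_lower_bound_near_zero by blast
  obtain q where q: "0 < q" "q \<le> 1" and
    cone: "\<And>x. x \<in> \<Omega> \<Longrightarrow> \<exists>e. norm e = 1 \<and> truncated_cone x e q q \<subseteq> \<Omega>"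
    by (rule uniform_interior_cone[OF assms(1-3)], rule that)
  show ?thesis
  proof (rule exI[of _ "r / 4"], intro conjI allI impI)
    show "0 < r / 4" using r by simp
  next
    fix p :: real and \<rho> :: "real^'d \<Rightarrow> real" and \<mu> :: "(real^'d) measure" and \<epsilon> :: "nat \<Rightarrow> real"
      and V :: "nat \<Rightarrow> (real^'d) set" and \<mu>V :: "nat \<Rightarrow> (real^'d) measure"
    assume p: "real CARD('d) < p" and \<rho>: "continuous_on \<Omega> \<rho>"
      and \<mu>: "\<mu> = density (restrict_space lborel \<Omega>) (\<lambda>x. ennreal (\<rho> x))"
      and eps: "\<forall>n\<ge>1. \<epsilon> n > 0" "\<epsilon> \<longlonglongrightarrow> 0"
      and V: "\<forall>n\<ge>1. finite (V n) \<and> V n \<subseteq> \<Omega> \<and>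
         sets (\<mu>V n) = sets (restrict_space borel (V n)) \<and> prob_space (\<mu>V n)"
      and KT: "\<exists>K T. 0 < K \<and> K \<le> r / 4 \<and>
       (\<forall>n\<ge>1. T n \<in> restrict_space borel \<Omega> \<rightarrow>\<^sub>M restrict_space borel (V n) \<and>
          distr \<mu> (restrict_space borel (V n)) (T n) = \<mu>V n \<and>
          (\<forall>x\<in>\<Omega>. norm (T n x - x) \<le> K * \<epsilon> n))"
      and mono: "antimono_on {0..} \<eta>"
      and D: "\<exists>D>0. \<forall>x\<in>\<Omega>. 1 / D \<le> \<rho> x \<and> \<rho> x \<le> D"
      and t: "\<exists>t>p. kernel_moment CARD('d) \<eta> t < \<infinity>"
    obtain K T where K: "0 < K" "K \<le> r / 4"
      and T: "\<And>n. n \<ge> 1 \<Longrightarrow> T n \<in> restrict_space borel \<Omega> \<rightarrow>\<^sub>M restrict_space borel (V n) \<and>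
          distr \<mu> (restrict_space borel (V n)) (T n) = \<mu>V n \<and> (\<forall>x\<in>\<Omega>. norm (T n x - x) \<le> K * \<epsilon> n)"
      using KT by blast
    obtain D where D: "D > 0" "\<And>x. x \<in> \<Omega> \<Longrightarrow> 1 / D \<le> \<rho> x \<and> \<rho> x \<le> D" using D by blast
    obtain t where t: "t > p" "kernel_moment CARD('d) \<eta> t < \<infinity>" using t by blast
    have "real CARD('d) \<ge> 1" by simp
    then have p1: "p > 1" "p > 0" using p by linarith+
    obtain e0 where e0: "0 < e0" "\<And>n. \<epsilon> n \<le> e0"
    proof -
      obtain b where b: "b > 0" "\<And>n. norm (\<epsilon> n) \<le> b"
        using convergent_imp_Bseq[OF convergentI[OF eps(2)]] unfolding Bseq_def by blast
      show ?thesis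
      proof (rule that[OF b(1)])
        show "\<epsilon> n \<le> b" for n using b(2)[of n] by simp
      qed
    qed
    have G: "transported_kernel_graph \<Omega> \<rho> \<mu> (V n) (\<mu>V n) (T n) (\<epsilon> n) K D \<eta> (\<eta> 0 / 2) r p"
      if n: "n \<ge> 1" for n
    proof -
      have 1: "finite (V n)" "V n \<subseteq> \<Omega>" "sets (\<mu>V n) = sets (restrict_space borel (V n))" "prob_space (\<mu>V n)"
        using V n by blast+
      have 2: "T n \<in> restrict_space borel \<Omega> \<rightarrow>\<^sub>M restrict_space borel (V n)"
        "distr \<mu> (restrict_space borel (V n)) (T n) = \<mu>V n" "\<And>x. x \<in> \<Omega> \<Longrightarrow> norm (T n x - x) \<le> K * \<epsilon> n"
        using T[OF n] by blast+
      have 3: "\<And>x. x \<in> \<Omega> \<Longrightarrow> 1 / D \<le> \<rho> x" "\<And>x. x \<in> \<Omega> \<Longrightarrow> \<rho> x \<le> D" using D(2) by blast+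
      have 4: "\<And>s. 0 \<le> s \<Longrightarrow> 0 \<le> \<eta> s" "0 < \<eta> 0 / 2" "0 < \<epsilon> n" using assms(4) True eps(1) n by auto
      show ?thesis
        by (intro transported_kernel_graph.intro transported_graph.intro transported_kernel_graph_axioms.intro)
          (fact 1 2 3 4 assms(1) \<rho> \<mu> K D(1) r p)+
    qed
    then have G': "transported_graph \<Omega> \<rho> \<mu> (V n) (\<mu>V n) (T n) (\<epsilon> n) K D" if "n \<ge> 1" for n
      using that by (simp add: transported_kernel_graph_def)
    have sobolev: "uniform_graph_sobolev \<eta> p \<epsilon> V \<mu>V"
      if "\<And>n x. n \<ge> 1 \<Longrightarrow> x \<in> V n \<Longrightarrow>
        measure (\<mu>V n) {x} > 0 \<and> \<epsilon> n powr p / measure (\<mu>V n) {x} \<le> \<Gamma>" for \<Gamma>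
      by (rule uniform_graph_sobolev_if_mass_lower_bound[OF G q cone e0 that])
    have epsn: "\<epsilon> n > 0" and Vn: "finite (V n)" if "n \<ge> 1" for n using that eps(1) V by auto
    show "uniform_graph_sobolev \<eta> p \<epsilon> V \<mu>V" if "mass_ratio_bounded p \<epsilon> V \<mu>V"
      by (rule mass_ratio_bounded_imp_mass_lower_bound[OF that Vn]) (assumption, rule sobolev)
    assume "\<exists>D>0. \<forall>n\<ge>1. \<forall>x\<in>V n. 1 / (D * real (card (V n))) \<le> measure (\<mu>V n) {x} \<and>
                             measure (\<mu>V n) {x} \<le> D / real (card (V n))"
    then obtain H where H: "H > 0"
      "\<And>n x. n \<ge> 1 \<Longrightarrow> x \<in> V n \<Longrightarrow> 1 / (H * real (card (V n))) \<le> measure (\<mu>V n) {x}"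
      "\<And>n x. n \<ge> 1 \<Longrightarrow> x \<in> V n \<Longrightarrow> measure (\<mu>V n) {x} \<le> H / real (card (V n))"
      by blast
    show "uniform_graph_sobolev \<eta> p \<epsilon> V \<mu>V \<longleftrightarrow>
      bounded ((\<lambda>n. \<epsilon> n * real (card (V n)) powr (1 / p)) ` {1..})"
    proof
      assume "uniform_graph_sobolev \<eta> p \<epsilon> V \<mu>V"
      then show "bounded ((\<lambda>n. \<epsilon> n * real (card (V n)) powr (1 / p)) ` {1..})"
        using t p1 by (intro bounded_if_uniform_graph_sobolev[OF G' assms(4) mono _ t(2) p1(2) e0(2) H(1,3)]) auto
    next
      assume bnd: "bounded ((\<lambda>n. \<epsilon> n * real (card (V n)) powr (1 / p)) ` {1..})"
      show "uniform_graph_sobolev \<eta> p \<epsilon> V \<mu>V"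
        by (rule scaled_card_bounded_imp_mass_lower_bound[OF p1(2) _ _ H(1) _ bnd])
          (fact epsn, fact Vn, fact H(2), rule sobolev)
    qed
  qed
qed

end
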